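(* Let $X$ be a Stein manifold of dimension $n$. (i) If there exists a proper holomorphic map $\Phi\colon X\to\mathbb{C}^{n+1}$ such that $\Phi^{-1}(\mathbb{C}\mathbb{R}^{n+1})$ is compact, then $X$ is $S^*$-parabolic. (ii) More generally, if there exists a proper holomorphic map $\Phi\colon X\to\mathbb{C}^N$, $N\ge n$, such that $\Phi^{-1}(\mathbb{C}\mathbb{R}^N)$ is compact and such that for every $z\in X$ there exists a tangent vector $w\neq0$ of $X$ at $z$ which is mapped by the derivative $d\Phi(z)$ into the complex linear span of $\Phi(z)$ and $\overline{\Phi(z)}$, then $X$ is $S^*$-parabolic.
   Context: $\mathbb{C}\mathbb{R}^{N}=\{\alpha a\,;\ \alpha\in\mathbb{C},\ a\in\mathbb{R}^{N}\}\subset\mathbb{C}^N$. A Stein manifold $X$ is $S^*$-parabolic if there exists a continuous parabolic potential on $X$, i.e. a continuous plurisubharmonic exhaustion function on $X$ (all sublevel sets relatively compact) which is maximal outside a compact subset of $X$. A plurisubharmonic function $u$ on an open set $\Omega$ is maximal if for every relatively compact open $G\subset\Omega$ and every upper semicontinuous $v$ on $\overline G$, plurisubharmonic on $G$, with $v\le u$ on $\partial G$, one has $v\le u$ on $G$. Tangent vectors are holomorphic tangent vectors and $d\Phi(z)$ is the complex differential. *)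

theory Defs
  imports "HOL-Analysis.Analysis"
begin

section \<open>Complex manifolds\<close>

text \<open>
  A complex manifold of dimension \<open>CARD('n)\<close> is a Hausdorff, second countable type \<open>'a\<close> together
  with a holomorphic atlas; the atlas need not be maximal. A chart is a domain with a coordinate map,
  whose values outside the domain are irrelevant.
\<close>

type_synonym ('a, 'n) chart = "'a set \<times> ('a \<Rightarrow> complex^'n)"

definition holomorphic_fun_on :: "(complex^'n \<Rightarrow> complex) \<Rightarrow> (complex^'n) set \<Rightarrow> bool" where
  "holomorphic_fun_on f S \<longleftrightarrow>
     (\<forall>x\<in>S. \<exists>f'. (f has_derivative f') (at x) \<and> Vector_Spaces.linear (*s) (*) f')"

definition complex_atlas ::
    "('a::{t2_space,second_countable_topology}, 'n::finite) chart set \<Rightarrow> bool" where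
  "complex_atlas A \<longleftrightarrow>
     (\<Union>(U, \<phi>)\<in>A. U) = UNIV \<and>
     (\<forall>(U, \<phi>)\<in>A. open U \<and> open (\<phi> ` U) \<and> homeomorphism U (\<phi> ` U) \<phi> (inv_into U \<phi>)) \<and>
     (\<forall>(U, \<phi>)\<in>A. \<forall>(V, \<psi>)\<in>A. \<forall>i.
        holomorphic_fun_on (\<lambda>x. \<psi> (inv_into U \<phi> x) $ i) (\<phi> ` (U \<inter> V)))"

definition holomorphic_fun :: "('a, 'n::finite) chart set \<Rightarrow> ('a \<Rightarrow> complex) \<Rightarrow> bool" where
  "holomorphic_fun A f \<longleftrightarrow> (\<forall>(U, \<phi>)\<in>A. holomorphic_fun_on (f \<circ> inv_into U \<phi>) (\<phi> ` U))"

definition holomorphic_map ::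
    "('a, 'n::finite) chart set \<Rightarrow> ('a \<Rightarrow> complex^'m::finite) \<Rightarrow> bool" where
  "holomorphic_map A F \<longleftrightarrow> (\<forall>i. holomorphic_fun A (\<lambda>x. F x $ i))"


section \<open>Tangent vectors and differentials\<close>

definition charts_at :: "('a, 'n) chart set \<Rightarrow> 'a \<Rightarrow> ('a, 'n) chart set" where
  "charts_at A z = {c \<in> A. z \<in> fst c}"

text \<open>
  A holomorphic tangent vector at \<open>z\<close> is the family of its coordinate vectors in all charts at \<open>z\<close>,
  transforming by the derivatives of the transition maps; the family is extended by \<open>0\<close> to
  everything that is not a chart at \<open>z\<close>, so that the zero tangent vector is \<open>\<lambda>_. 0\<close>.
  The real Frechet derivatives below are those of holomorphic maps, hence complex linear.
\<close>

definition tangent_space ::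
    "('a, 'n::finite) chart set \<Rightarrow> 'a \<Rightarrow> (('a, 'n) chart \<Rightarrow> complex^'n) set" where
  "tangent_space A z =
     {w. (\<forall>c. c \<notin> charts_at A z \<longrightarrow> w c = 0) \<and>
         (\<forall>(U, \<phi>)\<in>charts_at A z. \<forall>(V, \<psi>)\<in>charts_at A z.
            w (V, \<psi>) = frechet_derivative (\<psi> \<circ> inv_into U \<phi>) (at (\<phi> z)) (w (U, \<phi>)))}"

text \<open>By the chain rule, the value does not depend on the chart chosen at \<open>z\<close>.\<close>

definition differential ::
    "('a, 'n::finite) chart set \<Rightarrow> ('a \<Rightarrow> complex^'m::finite) \<Rightarrow> 'a
       \<Rightarrow> (('a, 'n) chart \<Rightarrow> complex^'n) \<Rightarrow> complex^'m" where
  "differential A F z w =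
     (let (U, \<phi>) = (SOME c. c \<in> charts_at A z)
      in frechet_derivative (F \<circ> inv_into U \<phi>) (at (\<phi> z)) (w (U, \<phi>)))"


section \<open>Stein manifolds\<close>

definition holomorphic_hull :: "('a, 'n::finite) chart set \<Rightarrow> 'a set \<Rightarrow> 'a set" where
  "holomorphic_hull A K =
     {x. \<forall>f. holomorphic_fun A f \<longrightarrow> (\<forall>C. (\<forall>y\<in>K. cmod (f y) \<le> C) \<longrightarrow> cmod (f x) \<le> C)}"

text \<open>
  The three classical conditions: holomorphic convexity, separation of points, and existence, at
  every point, of local coordinates given by global holomorphic functions (that is, a holomorphic
  map to \<open>complex^'n\<close> whose differential is injective there).
\<close>

definition stein_manifold ::
    "('a::{t2_space,second_countable_topology}, 'n::finite) chart set \<Rightarrow> bool" where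
  "stein_manifold A \<longleftrightarrow>
     complex_atlas A \<and>
     (\<forall>K. compact K \<longrightarrow> compact (holomorphic_hull A K)) \<and>
     (\<forall>x y. x \<noteq> y \<longrightarrow> (\<exists>f. holomorphic_fun A f \<and> f x \<noteq> f y)) \<and>
     (\<forall>z. \<exists>F :: 'a \<Rightarrow> complex^'n.
        holomorphic_map A F \<and> inj_on (differential A F z) (tangent_space A z))"


section \<open>Plurisubharmonic functions\<close>

text \<open>
  Functions take values in \<open>[-\<infinity>, \<infinity>)\<close>; the constant \<open>-\<infinity>\<close> counts as (pluri)subharmonic.
\<close>

definition usc_on :: "'a::topological_space set \<Rightarrow> ('a \<Rightarrow> ereal) \<Rightarrow> bool" where
  "usc_on S f \<longleftrightarrow>
     (\<forall>x\<in>S. f x < \<infinity>) \<and> (\<forall>c. openin (top_of_set S) {x \<in> S. f x < c})"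

text \<open>
  The integral of the positive part minus that of the negative part. The former is finite whenever
  \<open>f\<close> is upper semicontinuous and \<open>< \<infinity>\<close> on the circle, so the mean then lies in \<open>[-\<infinity>, \<infinity>)\<close>.
\<close>

definition circle_mean :: "(complex \<Rightarrow> ereal) \<Rightarrow> complex \<Rightarrow> real \<Rightarrow> ereal" where
  "circle_mean f z r =
     (enn2ereal (\<integral>\<^sup>+\<theta>\<in>{0..2*pi}. e2ennreal (f (z + of_real r * cis \<theta>)) \<partial>lborel)
      - enn2ereal (\<integral>\<^sup>+\<theta>\<in>{0..2*pi}. e2ennreal (- f (z + of_real r * cis \<theta>)) \<partial>lborel))
     / ereal (2 * pi)"

definition subharmonic_on :: "complex set \<Rightarrow> (complex \<Rightarrow> ereal) \<Rightarrow> bool" where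
  "subharmonic_on V f \<longleftrightarrow>
     usc_on V f \<and> (\<forall>z r. 0 < r \<and> cball z r \<subseteq> V \<longrightarrow> f z \<le> circle_mean f z r)"

definition psh_on :: "(complex^'n::finite) set \<Rightarrow> (complex^'n \<Rightarrow> ereal) \<Rightarrow> bool" where
  "psh_on D f \<longleftrightarrow>
     usc_on D f \<and>
     (\<forall>a v. subharmonic_on {\<zeta>. a + \<zeta> *s v \<in> D} (\<lambda>\<zeta>. f (a + \<zeta> *s v)))"

definition plurisubharmonic ::
    "('a::topological_space, 'n::finite) chart set \<Rightarrow> 'a set \<Rightarrow> ('a \<Rightarrow> ereal) \<Rightarrow> bool" where
  "plurisubharmonic A \<Omega> u \<longleftrightarrow> (\<forall>(U, \<phi>)\<in>A. psh_on (\<phi> ` (U \<inter> \<Omega>)) (u \<circ> inv_into U \<phi>))"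

definition maximal_psh ::
    "('a::topological_space, 'n::finite) chart set \<Rightarrow> 'a set \<Rightarrow> ('a \<Rightarrow> ereal) \<Rightarrow> bool" where
  "maximal_psh A \<Omega> u \<longleftrightarrow>
     plurisubharmonic A \<Omega> u \<and>
     (\<forall>G v. open G \<and> compact (closure G) \<and> closure G \<subseteq> \<Omega> \<and>
            usc_on (closure G) v \<and> plurisubharmonic A G v \<and> (\<forall>x\<in>frontier G. v x \<le> u x)
            \<longrightarrow> (\<forall>x\<in>G. v x \<le> u x))"

definition continuous_parabolic_potential ::
    "('a::topological_space, 'n::finite) chart set \<Rightarrow> ('a \<Rightarrow> real) \<Rightarrow> bool" where
  "continuous_parabolic_potential A u \<longleftrightarrow>
     continuous_on UNIV u \<and>
     plurisubharmonic A UNIV (\<lambda>x. ereal (u x)) \<and>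
     (\<forall>c. compact (closure {x. u x \<le> c})) \<and>
     (\<exists>K. compact K \<and> maximal_psh A (- K) (\<lambda>x. ereal (u x)))"

definition S_star_parabolic ::
    "('a::{t2_space,second_countable_topology}, 'n::finite) chart set \<Rightarrow> bool" where
  "S_star_parabolic A \<longleftrightarrow> stein_manifold A \<and> (\<exists>u. continuous_parabolic_potential A u)"


section \<open>Subsets of complex coordinate space\<close>

definition CR :: "(complex^'m::finite) set" where
  "CR = {\<alpha> *s (\<chi> i. complex_of_real (a $ i)) | \<alpha> (a :: real^'m). True}"

definition cnj_vec :: "complex^'m::finite \<Rightarrow> complex^'m" where
  "cnj_vec v = (\<chi> i. cnj (v $ i))"

end

theory Submission
  imports Defs "HOL-Complex_Analysis.Conformal_Mappings"
begin

text \<open>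
  The potential is the logarithm of the squared Lie norm
  \<open>L(z)\<^sup>2 = \<bar>z\<bar>\<^sup>2 + sqrt (\<bar>z\<bar>\<^sup>4 - \<bar>z \<sqdot> z\<bar>\<^sup>2)\<close> of \<open>\<Phi>\<close>, cut off near its zeros. As \<open>L\<close> is a maximum of the
  moduli of linear forms, the potential is plurisubharmonic. Off \<open>CR\<close> the maximum is attained at a form
  \<open>l\<close> whose modulus equals \<open>L\<close> near \<open>z\<close> on the plane spanned by \<open>z\<close> and its conjugate,
  so \<open>ln L\<close> is pluriharmonic along that plane. Hence \<open>ln L \<circ> \<Phi>\<close> has a degenerate Levi form wherever some
  tangent vector is mapped into the plane, which for \<open>N = n + 1\<close> holds by counting dimensions, and
  a maximum principle argument with a strictly plurisubharmonic perturbation gives maximality.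
  For \<open>N = 1\<close>, \<open>CR\<close> is everything and \<open>X\<close> is compact.
\<close>

section \<open>Means over circles\<close>

text \<open>The cut-off potential is not smooth and a competitor \<open>v\<close> is only upper
  semicontinuous, so no Levi form is ever computed; one-sided comparison functions replace it.
  Moduli of holomorphic functions touching the exponential of the potential from below give
  plurisubharmonicity. On a tangent disc, the real part of a holomorphic function bounds the
  potential from above up to an arbitrarily small multiple of \<open>(cmod \<zeta>)\<^sup>2\<close>,
  and the quadratic gain of the strictly plurisubharmonic perturbation beats that error. The set
  \<open>CR\<close> enters through the frames: a unit scalar turns z into x + i y with x, y real and
  orthogonal and |y| <= |x|. The Lie norm of z is |x| + |y|, attained by a form l, while the
  conjugate of l yields |x| - |y|. The two tie exactly when y = 0, that is, on \<open>CR\<close>;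
  off \<open>CR\<close> the gap between them is the denominator in the upper estimate of
  \<open>lie2\<close>.\<close>

definition circle_avg :: "(complex \<Rightarrow> real) \<Rightarrow> complex \<Rightarrow> real \<Rightarrow> real" where
  "circle_avg g z r = integral {0..2*pi} (\<lambda>\<theta>. g (z + of_real r * cis \<theta>)) / (2*pi)"

lemma continuous_on_circle:
  assumes "continuous_on (sphere z r) g" "0 < r"
  shows "continuous_on S (\<lambda>\<theta>. g (z + of_real r * cis \<theta>))"
  by (rule continuous_on_compose2[OF assms(1)])
     (use assms(2) in \<open>auto intro!: continuous_intros simp: dist_norm norm_mult\<close>)

lemma circle_avg_has_integral:
  assumes "continuous_on (sphere z r) g" "0 < r"
  shows "((\<lambda>\<theta>. g (z + of_real r * cis \<theta>)) has_integral (2*pi * circle_avg g z r)) {0..2*pi}"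
  using integrable_integral[OF integrable_continuous_real[OF continuous_on_circle[OF assms]], of 0 "2*pi"]
  by (simp add: circle_avg_def)

lemma circle_avg_mono:
  assumes "continuous_on (sphere z r) f" "continuous_on (sphere z r) g" "0 < r"
    and le: "\<And>w. dist z w = r \<Longrightarrow> f w \<le> g w"
  shows "circle_avg f z r \<le> circle_avg g z r"
proof -
  have "2*pi * circle_avg f z r \<le> 2*pi * circle_avg g z r"
    by (rule has_integral_le[OF circle_avg_has_integral[OF assms(1,3)] circle_avg_has_integral[OF assms(2,3)]])
       (use \<open>0 < r\<close> in \<open>auto intro!: le simp: dist_norm norm_mult\<close>)
  then show ?thesis by simp
qed

lemma circle_avg_add_const:
  assumes "continuous_on (sphere z r) f" "0 < r"
  shows "circle_avg (\<lambda>w. f w + c) z r = circle_avg f z r + c"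
proof -
  have "((\<lambda>\<theta>. f (z + of_real r * cis \<theta>) + c) has_integral (2*pi * circle_avg f z r + 2*pi*c)) {0..2*pi}"
    using has_integral_add[OF circle_avg_has_integral[OF assms] has_integral_const_real[of c 0 "2*pi"]]
    by (simp add: mult_ac)
  from integral_unique[OF this] show ?thesis
    by (simp add: circle_avg_def add_divide_distrib)
qed

lemma circle_avg_Re_holomorphic:
  assumes "continuous_on (cball z r) h" "h holomorphic_on ball z r" "0 < r"
  shows "circle_avg (\<lambda>w. Re (h w)) z r = Re (h z)"
proof -
  have "((\<lambda>u. h u / (u - z)) has_contour_integral (2 * of_real pi * \<i> * h z)) (part_circlepath z r 0 (2*pi))"
    using Cauchy_integral_circlepath[OF assms(1,2), of z] \<open>0 < r\<close> by (simp add: circlepath_def)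
  then have "((\<lambda>t. h (z + r * cis t) / (z + r * cis t - z) * r * \<i> * cis t)
       has_integral (2 * of_real pi * \<i> * h z)) {0..2*pi}"
    by (subst (asm) has_contour_integral_part_circlepath_iff) auto
  then have "((\<lambda>t. \<i> * h (z + r * cis t)) has_integral (2 * of_real pi * \<i> * h z)) {0..2*pi}"
    by (rule has_integral_eq[rotated]) (use \<open>0 < r\<close> in \<open>simp add: field_simps\<close>)
  \<comment> \<open>The contour integral carries a factor i, so the mean of the real part shows up
    as an imaginary part.\<close>
  from has_integral_Im[OF this]
  have "((\<lambda>t. Re (h (z + r * cis t))) has_integral (2 * pi * Re (h z))) {0..2*pi}" by simp
  from integral_unique[OF this] show ?thesis
    by (simp add: circle_avg_def)
qed

text \<open>The two nonnegative integrals are monotone for arbitrary integrands, measurable or not.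
  Hence a merely semicontinuous competitor can be compared directly with a continuous
  majorant.\<close>

lemma circle_mean_mono:
  assumes "0 < r" and le: "\<And>w. dist z w = r \<Longrightarrow> f w \<le> g w"
  shows "circle_mean f z r \<le> circle_mean g z r"
proof -
  have *: "f (z + of_real r * cis \<theta>) \<le> g (z + of_real r * cis \<theta>)" for \<theta>
    using \<open>0 < r\<close> by (intro le) (simp add: dist_norm norm_mult)
  have 1: "enn2ereal (\<integral>\<^sup>+\<theta>\<in>{0..2*pi}. e2ennreal (f (z + of_real r * cis \<theta>)) \<partial>lborel)
     \<le> enn2ereal (\<integral>\<^sup>+\<theta>\<in>{0..2*pi}. e2ennreal (g (z + of_real r * cis \<theta>)) \<partial>lborel)"
    by (intro less_eq_ennreal.rep_eq[THEN iffD1] nn_integral_mono mult_right_mono e2ennreal_mono *) auto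
  have 2: "enn2ereal (\<integral>\<^sup>+\<theta>\<in>{0..2*pi}. e2ennreal (- g (z + of_real r * cis \<theta>)) \<partial>lborel)
     \<le> enn2ereal (\<integral>\<^sup>+\<theta>\<in>{0..2*pi}. e2ennreal (- f (z + of_real r * cis \<theta>)) \<partial>lborel)"
    by (intro less_eq_ennreal.rep_eq[THEN iffD1] nn_integral_mono mult_right_mono e2ennreal_mono
        ereal_minus_le_minus[THEN iffD2] *) auto
  show ?thesis
    unfolding circle_mean_def
    by (intro ereal_divide_right_mono ereal_minus_mono 1 2) auto
qed

text \<open>Links the two notions of mean: continuity on the circle makes both integrals in
  \<open>circle_mean\<close> finite, so their extended difference is an ordinary real
  integral.\<close>

lemma circle_mean_ereal:
  assumes "continuous_on (sphere z r) g" "0 < r"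
  shows "circle_mean (\<lambda>w. ereal (g w)) z r = ereal (circle_avg g z r)"
proof -
  define k where "k = (\<lambda>\<theta>. g (z + of_real r * cis \<theta>))"
  have k: "set_integrable lborel {0..2*pi} k"
    unfolding k_def by (rule borel_integrable_atLeastAtMost') (rule continuous_on_circle[OF assms])
  then have ki: "integrable lborel (\<lambda>x. indicator {0..2*pi} x * k x)"
    by (simp add: set_integrable_def)
  have e2: "e2ennreal (ereal x) = ennreal x" for x
    by (simp add: ennreal.abs_eq ennreal_def)
  have pos: "(\<integral>\<^sup>+\<theta>\<in>{0..2*pi}. e2ennreal (ereal (k \<theta>)) \<partial>lborel)
     = (\<integral>\<^sup>+x. ennreal (indicator {0..2*pi} x * k x) \<partial>lborel)"
    by (intro nn_integral_cong) (auto simp: indicator_def e2)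
  have neg: "(\<integral>\<^sup>+\<theta>\<in>{0..2*pi}. e2ennreal (- ereal (k \<theta>)) \<partial>lborel)
     = (\<integral>\<^sup>+x. ennreal (- (indicator {0..2*pi} x * k x)) \<partial>lborel)"
    by (intro nn_integral_cong) (auto simp: indicator_def e2)
  have fin: "(\<integral>\<^sup>+x. ennreal (indicator {0..2*pi} x * k x) \<partial>lborel) < \<infinity>"
      "(\<integral>\<^sup>+x. ennreal (- (indicator {0..2*pi} x * k x)) \<partial>lborel) < \<infinity>"
    using ki by (auto simp: real_integrable_def less_top)
  have conv: "enn2ereal a - enn2ereal b = ereal (enn2real a - enn2real b)"
    if "a < \<infinity>" "b < \<infinity>" for a b
    using that by (cases a; cases b) auto
  have "integral {0..2*pi} k = (LINT x|lborel. indicator {0..2*pi} x * k x)"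
    using set_borel_integral_eq_integral[OF k] by (simp add: set_lebesgue_integral_def)
  also have "\<dots> = enn2real (\<integral>\<^sup>+x. ennreal (indicator {0..2*pi} x * k x) \<partial>lborel)
        - enn2real (\<integral>\<^sup>+x. ennreal (- (indicator {0..2*pi} x * k x)) \<partial>lborel)"
    by (rule real_lebesgue_integral_def[OF ki])
  finally have "circle_mean (\<lambda>w. ereal (g w)) z r = ereal (integral {0..2*pi} k) / ereal (2*pi)"
    unfolding circle_mean_def k_def[symmetric, THEN fun_cong] pos neg by (simp add: conv[OF fin])
  then show ?thesis by (simp add: circle_avg_def k_def)
qed

section \<open>Real parts of polynomials on a circle\<close>

inductive circle_poly :: "complex \<Rightarrow> (complex \<Rightarrow> real) \<Rightarrow> bool" for z where
  monom: "circle_poly z (\<lambda>w. Re (c * (w - z) ^ k))"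
| add: "circle_poly z f \<Longrightarrow> circle_poly z g \<Longrightarrow> circle_poly z (\<lambda>w. f w + g w)"

lemma circle_poly_Re_entire:
  "circle_poly z f \<Longrightarrow> \<exists>P. P holomorphic_on UNIV \<and> f = (\<lambda>w. Re (P w))"
proof (induction rule: circle_poly.induct)
  case (monom c k)
  show ?case by (intro exI[of _ "\<lambda>w. c * (w - z) ^ k"]) (auto intro!: holomorphic_intros)
next
  case (add f g)
  then obtain P Q where "P holomorphic_on UNIV" "f = (\<lambda>w. Re (P w))"
    "Q holomorphic_on UNIV" "g = (\<lambda>w. Re (Q w))" by blast
  then show ?case by (intro exI[of _ "\<lambda>w. P w + Q w"]) (auto intro!: holomorphic_intros)
qed

text \<open>On the circle, \<open>cnj (w - z)\<close> is a multiple of \<open>1 / (w - z)\<close>, so products reduce to monomials.\<close>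

lemma Re_monom_mult:
  "\<exists>h. circle_poly z h \<and> (\<forall>w\<in>sphere z r. Re (c * (w - z)^j) * Re (d * (w - z)^k) = h w)"
proof -
  have main: "\<exists>h. circle_poly z h \<and> (\<forall>w\<in>sphere z r. Re (c * (w - z)^j) * Re (d * (w - z)^k) = h w)"
    if "k \<le> j" for c d j k
  proof (intro exI conjI ballI)
    \<comment> \<open>From \<open>Re a * Re b = Re (a * b / 2) + Re (a * cnj b / 2)\<close>. In the
      second term the conjugate power is traded for \<open>r^(2*k)\<close> over
      \<open>(w - z)^k\<close>, and \<open>k \<le> j\<close> keeps the resulting exponent
      nonnegative.\<close>
    show "circle_poly z (\<lambda>w. Re ((c * d / 2) * (w - z)^(j + k))
        + Re ((c * cnj d * of_real r^(2*k) / 2) * (w - z)^(j - k)))"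
      by (intro circle_poly.intros)
    fix w assume "w \<in> sphere z r"
    then have "(w - z) * cnj (w - z) = of_real r ^ 2"
      by (subst complex_norm_square[symmetric]) (auto simp: dist_norm norm_minus_commute)
    then have "(w - z)^k * cnj (w - z)^k = of_real r^(2*k)"
      by (metis power_mult power_mult_distrib)
    then have *: "of_real r^(2*k) * (w - z)^(j - k) = (w - z)^j * cnj (w - z)^k"
      using that by (metis (no_types, lifting) le_add_diff_inverse2 mult.assoc mult.commute power_add)
    have "Re a * Re b = Re (a * b / 2) + Re (a * cnj b / 2)" for a b
      by (simp add: field_simps)
    from this[of "c * (w - z)^j" "d * (w - z)^k"]
    show "Re (c * (w - z)^j) * Re (d * (w - z)^k) = Re ((c * d / 2) * (w - z)^(j + k))
        + Re ((c * cnj d * of_real r^(2*k) / 2) * (w - z)^(j - k))"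
      using * by (simp add: power_add mult_ac)
  qed
  show ?thesis
  proof (cases "k \<le> j")
    case False
    then show ?thesis using main[of j k d c] by (simp add: mult.commute)
  qed (rule main)
qed

lemma circle_poly_mult:
  assumes "circle_poly z f" "circle_poly z g"
  shows "\<exists>h. circle_poly z h \<and> (\<forall>w\<in>sphere z r. f w * g w = h w)"
  using assms(1)
proof (induction rule: circle_poly.induct)
  case (monom c j)
  show ?case using assms(2)
  proof (induction rule: circle_poly.induct)
    case (monom d k)
    show ?case by (rule Re_monom_mult)
  next
    case (add g1 g2)
    then obtain h1 h2 where "circle_poly z h1" "circle_poly z h2"
      "\<forall>w\<in>sphere z r. Re (c * (w - z)^j) * g1 w = h1 w"
      "\<forall>w\<in>sphere z r. Re (c * (w - z)^j) * g2 w = h2 w" by blast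
    then show ?case
      by (intro exI[of _ "\<lambda>w. h1 w + h2 w"]) (auto intro: circle_poly.add simp: distrib_left)
  qed
next
  case (add f1 f2)
  then obtain h1 h2 where "circle_poly z h1" "circle_poly z h2"
    "\<forall>w\<in>sphere z r. f1 w * g w = h1 w" "\<forall>w\<in>sphere z r. f2 w * g w = h2 w" by blast
  then show ?case
    by (intro exI[of _ "\<lambda>w. h1 w + h2 w"]) (auto intro: circle_poly.add simp: distrib_right)
qed

text \<open>An approximate solution of the Dirichlet problem in the disc, with Stone-Weierstrass in
  the place of the Poisson integral. Having the harmonic function as the real part of an entire
  \<open>P\<close> makes \<open>exp (- P)\<close> available as a holomorphic factor.\<close>

lemma circle_approx_Re_entire:
  assumes "continuous_on (sphere z r) g" "0 < e"
  obtains P where "P holomorphic_on UNIV" "\<And>w. w \<in> sphere z r \<Longrightarrow> \<bar>g w - Re (P w)\<bar> < e"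
proof -
  \<comment> \<open>Only agreement on the circle is demanded, because the reduction of products to
    monomials is valid only there.\<close>
  define Q where "Q f \<longleftrightarrow> (\<exists>h. circle_poly z h \<and> (\<forall>w\<in>sphere z r. f w = h w))" for f
  have "\<exists>g'. Q g' \<and> (\<forall>x \<in> sphere z r. \<bar>g x - g' x\<bar> < e)"
  proof (rule Stone_Weierstrass_HOL)
    show "Q (\<lambda>x. c)" for c
      unfolding Q_def using circle_poly.monom[of z "of_real c" 0] by (intro exI) auto
    show "continuous_on (sphere z r) f" if "Q f" for f
    proof -
      obtain h where h: "circle_poly z h" "\<forall>w\<in>sphere z r. f w = h w"
        using \<open>Q f\<close> unfolding Q_def by metis
      then obtain P where P: "P holomorphic_on UNIV" "h = (\<lambda>w. Re (P w))"
        using circle_poly_Re_entire by blast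
      have "continuous_on (sphere z r) (\<lambda>w. Re (P w))"
        by (intro continuous_intros holomorphic_on_imp_continuous_on holomorphic_on_subset[OF P(1)]) auto
      then show ?thesis using h(2) P(2) by (metis (no_types, lifting) continuous_on_cong)
    qed
    show "Q (\<lambda>x. f x + h x)" if "Q f \<and> Q h" for f h
      using that unfolding Q_def by (metis (mono_tags, lifting) circle_poly.add)
    show "Q (\<lambda>x. f x * h x)" if "Q f \<and> Q h" for f h
    proof -
      obtain f' h' where *: "circle_poly z f'" "\<forall>w\<in>sphere z r. f w = f' w"
        "circle_poly z h'" "\<forall>w\<in>sphere z r. h w = h' w"
        using \<open>Q f \<and> Q h\<close> unfolding Q_def by blast
      show ?thesis using circle_poly_mult[OF *(1,3), of r] *(2,4) unfolding Q_def by simp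
    qed
    show "\<exists>f. Q f \<and> f x \<noteq> f y" if "x \<in> sphere z r \<and> y \<in> sphere z r \<and> x \<noteq> y" for x y
    proof -
      have "Re (1 * (x - z) ^ 1) \<noteq> Re (1 * (y - z) ^ 1)
          \<or> Re (\<i> * (x - z) ^ 1) \<noteq> Re (\<i> * (y - z) ^ 1)"
        using that by (auto simp: complex_eq_iff)
      moreover have "Q (\<lambda>w. Re (c * (w - z) ^ 1))" for c
        unfolding Q_def using circle_poly.monom[of z c 1] by blast
      ultimately show ?thesis by meson
    qed
  qed (use assms in auto)
  then obtain g' where g': "Q g'" "\<forall>x \<in> sphere z r. \<bar>g x - g' x\<bar> < e" by blast
  then obtain h where "circle_poly z h" "\<forall>w\<in>sphere z r. g' w = h w"
    unfolding Q_def by blast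
  with g' that show ?thesis using circle_poly_Re_entire by metis
qed

text \<open>The maximum principle applied to \<open>s * exp (- P)\<close>, where \<open>Re P\<close> approximates \<open>g\<close> on the circle:
  this spares us from dividing out the zeros of \<open>s\<close>.\<close>

lemma cmod_le_exp_circle_avg:
  assumes s: "continuous_on (cball z r) s" "s holomorphic_on ball z r" and "0 < r"
    and g: "continuous_on (sphere z r) g"
    and le: "\<And>w. dist z w = r \<Longrightarrow> cmod (s w) \<le> exp (g w)"
  shows "cmod (s z) \<le> exp (circle_avg g z r)"
proof -
  \<comment> \<open>One \<open>e\<close> is lost in the maximum principle on the circle, the other
    in comparing the mean of \<open>Re (P w)\<close> with that of \<open>g\<close>.\<close>
  have "cmod (s z) \<le> exp (circle_avg g z r + 2 * e)" if "e > 0" for e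
  proof -
    obtain P where P: "P holomorphic_on UNIV" "\<And>w. w \<in> sphere z r \<Longrightarrow> \<bar>g w - Re (P w)\<bar> < e"
      using circle_approx_Re_entire[OF g \<open>e > 0\<close>] by blast
    have Pc: "continuous_on S P" for S
      using P(1) holomorphic_on_imp_continuous_on holomorphic_on_subset by blast
    have "cmod (s z * exp (- P z)) \<le> exp e"
    proof (rule maximum_modulus_frontier[where S = "cball z r" and f = "\<lambda>w. s w * exp (- P w)"])
      show "(\<lambda>w. s w * exp (- P w)) holomorphic_on interior (cball z r)"
        by (auto intro!: holomorphic_intros s holomorphic_on_subset[OF P(1)])
      show "continuous_on (closure (cball z r)) (\<lambda>w. s w * exp (- P w))"
        by (auto intro!: continuous_intros s Pc)
      fix w assume "w \<in> frontier (cball z r)"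
      then have w: "dist z w = r" by simp
      have "cmod (s w * exp (- P w)) \<le> exp (g w) * exp (- Re (P w))"
        using le[OF w] by (simp add: norm_mult mult_right_mono)
      also have "\<dots> \<le> exp e"
        using P(2)[of w] w by (simp add: exp_add[symmetric])
      finally show "cmod (s w * exp (- P w)) \<le> exp e" .
    qed (use \<open>0 < r\<close> in auto)
    then have "cmod (s z) * exp (- Re (P z)) \<le> exp e" by (simp add: norm_mult)
    then have 1: "cmod (s z) \<le> exp (e + Re (P z))"
      by (simp add: exp_add exp_minus field_simps)
    have "Re (P z) = circle_avg (\<lambda>w. Re (P w)) z r"
      by (rule circle_avg_Re_holomorphic[symmetric, OF Pc holomorphic_on_subset[OF P(1)] \<open>0 < r\<close>]) auto
    also have "\<dots> \<le> circle_avg (\<lambda>w. g w + e) z r"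
    proof (rule circle_avg_mono)
      fix w assume "dist z w = r"
      then show "Re (P w) \<le> g w + e" using P(2)[of w] by (simp add: abs_less_iff)
    qed (auto intro!: continuous_intros g Pc \<open>0 < r\<close>)
    also have "\<dots> = circle_avg g z r + e" by (rule circle_avg_add_const[OF g \<open>0 < r\<close>])
    finally have "e + Re (P z) \<le> circle_avg g z r + 2 * e" by simp
    with 1 show ?thesis by (meson exp_le_cancel_iff order_trans)
  qed
  then have "\<forall>\<^sub>F e in at_right 0. cmod (s z) \<le> exp (circle_avg g z r + 2 * e)"
    by (simp add: eventually_at_right_less eventually_at_filter)
  moreover have "((\<lambda>e. exp (circle_avg g z r + 2 * e)) \<longlongrightarrow> exp (circle_avg g z r + 2 * 0)) (at_right 0)"
    by (intro tendsto_intros)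
  ultimately show ?thesis
    using tendsto_lowerbound by fastforce
qed

section \<open>The Lie norm\<close>

text \<open>Bilinear rather than Hermitian, so that \<open>bil l\<close> is a holomorphic linear
  form; the norm is recovered by pairing with \<open>cnj_vec\<close>.\<close>

definition bil :: "complex^'m::finite \<Rightarrow> complex^'m \<Rightarrow> complex" where
  "bil x y = (\<Sum>i\<in>UNIV. x $ i * y $ i)"

lemma bil_simps:
  "bil (x + y) z = bil x z + bil y z" "bil z (x + y) = bil z x + bil z y"
  "bil (x - y) z = bil x z - bil y z" "bil z (x - y) = bil z x - bil z y"
  "bil (c *s x) y = c * bil x y" "bil x (c *s y) = c * bil x y"
  by (simp_all add: bil_def sum.distrib sum_subtractf sum_distrib_left algebra_simps)

lemma bil_commute: "bil x y = bil y x"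
  by (simp add: bil_def mult.commute)

lemma cnj_vec_simps [simp]:
  "cnj_vec (x + y) = cnj_vec x + cnj_vec y" "cnj_vec (x - y) = cnj_vec x - cnj_vec y"
  "cnj_vec (c *s x) = cnj c *s cnj_vec x" "cnj_vec (cnj_vec x) = x"
  by (simp_all add: cnj_vec_def vec_eq_iff)

lemma cnj_bil: "cnj (bil x y) = bil (cnj_vec x) (cnj_vec y)"
  by (simp add: bil_def cnj_vec_def)

lemma bil_cnj_vec: "bil x (cnj_vec x) = of_real ((norm x)\<^sup>2)"
  by (simp add: bil_def cnj_vec_def norm_vec_def L2_set_def sum_nonneg complex_norm_square del: of_real_power)

lemma norm_bil_le: "cmod (bil x y) \<le> norm x * norm y"
proof -
  have "cmod (bil x y) \<le> (\<Sum>i\<in>UNIV. norm (x$i) * norm (y$i))"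
    unfolding bil_def by (rule order_trans[OF norm_sum]) (simp add: norm_mult)
  also have "\<dots> \<le> norm x * norm y"
    unfolding norm_vec_def using L2_set_mult_ineq[of "\<lambda>i. norm (x$i)" "\<lambda>i. norm (y$i)" UNIV] by simp
  finally show ?thesis .
qed

lemma continuous_on_bil [continuous_intros]:
  "continuous_on S f \<Longrightarrow> continuous_on S g \<Longrightarrow> continuous_on S (\<lambda>x. bil (f x) (g x))"
  unfolding bil_def by (intro continuous_intros)

text \<open>The square of the Lie norm; it is the maximum of \<open>\<bar>bil l z\<bar>\<^sup>2\<close> over the isotropic frames \<open>l\<close> below.\<close>

definition lie2 :: "complex^'m::finite \<Rightarrow> real" where
  "lie2 z = (norm z)\<^sup>2 + sqrt ((norm z)^4 - (cmod (bil z z))\<^sup>2)"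

lemma lie2_radicand_nonneg: "0 \<le> (norm z)^4 - (cmod (bil z z))\<^sup>2"
proof -
  have "(cmod (bil z z))\<^sup>2 \<le> (norm z * norm z)\<^sup>2"
    by (intro power_mono norm_bil_le) auto
  also have "\<dots> = (norm z)^4" by (simp add: power2_eq_square power4_eq_xxxx)
  finally show ?thesis by simp
qed

text \<open>This coercivity turns properness of the map into compactness of the sublevel sets of
  \<open>lie2\<close> along it.\<close>

lemma norm2_le_lie2: "(norm z)\<^sup>2 \<le> lie2 z"
  unfolding lie2_def using lie2_radicand_nonneg[of z] by simp

lemma continuous_on_lie2 [continuous_intros]:
  "continuous_on S f \<Longrightarrow> continuous_on S (\<lambda>x. lie2 (f x))"
  unfolding lie2_def by (intro continuous_intros)

text \<open>Such a vector is \<open>e\<^sub>1 + \<i> e\<^sub>2\<close> for a pair of orthonormal real vectors.\<close>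

definition isotropic_frame :: "complex^'m::finite \<Rightarrow> bool" where
  "isotropic_frame l \<longleftrightarrow> bil l l = 0 \<and> (norm l)\<^sup>2 = 2"

text \<open>For an isotropic frame, the orthogonal projection along the plane of \<open>l\<close>
  and \<open>cnj_vec l\<close>. As \<open>bil l l = 0\<close> and
  \<open>bil l (cnj_vec l) = 2\<close>, the form \<open>bil l\<close> reads off twice the
  coefficient of \<open>cnj_vec l\<close>, and conversely.\<close>

definition frame_perp :: "complex^'m::finite \<Rightarrow> complex^'m \<Rightarrow> complex^'m" where
  "frame_perp l z = z - (bil l z / 2) *s cnj_vec l - (bil (cnj_vec l) z / 2) *s l"

lemma frame_perp_simps:
  "frame_perp l (x + y) = frame_perp l x + frame_perp l y"
  "frame_perp l (c *s x) = c *s frame_perp l x"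
  by (simp_all add: frame_perp_def bil_simps vec_eq_iff field_simps)

lemma frame_perp_cnj_vec: "frame_perp l (cnj_vec z) = cnj_vec (frame_perp l z)"
  by (simp add: frame_perp_def cnj_bil)

context
  fixes l :: "complex^'m::finite"
  assumes l: "isotropic_frame l"
begin

lemma frame_bil: "bil l l = 0" "bil (cnj_vec l) (cnj_vec l) = 0"
    "bil l (cnj_vec l) = 2" "bil (cnj_vec l) l = 2"
  using l cnj_bil[of l l] bil_cnj_vec[of l] bil_commute[of l "cnj_vec l"]
  by (auto simp: isotropic_frame_def)

lemma bil_frame_perp:
  "bil l (frame_perp l z) = 0" "bil (cnj_vec l) (frame_perp l z) = 0"
  by (simp_all add: frame_perp_def bil_simps frame_bil)

lemma frame_decomp:
  "z = (bil l z / 2) *s cnj_vec l + (bil (cnj_vec l) z / 2) *s l + frame_perp l z"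
  by (simp add: frame_perp_def)

lemma bil_frame_decomp:
  "bil z z = bil l z * bil (cnj_vec l) z + bil (frame_perp l z) (frame_perp l z)"
proof -
  define a b q where "a = bil l z / 2" "b = bil (cnj_vec l) z / 2" "q = frame_perp l z"
  have q: "bil l q = 0" "bil (cnj_vec l) q = 0" "bil q l = 0" "bil q (cnj_vec l) = 0"
    using bil_frame_perp[of z] by (auto simp: a_b_q_def bil_commute[of "frame_perp l z"])
  have "bil z z = bil (a *s cnj_vec l + b *s l + q) (a *s cnj_vec l + b *s l + q)"
    using frame_decomp[of z] by (simp add: a_b_q_def)
  also have "\<dots> = 4 * a * b + bil q q"
    by (simp add: bil_simps frame_bil q)
  finally show ?thesis by (simp add: a_b_q_def)
qed

lemma norm2_frame_decomp:
  "(norm z)\<^sup>2 = ((cmod (bil l z))\<^sup>2 + (cmod (bil (cnj_vec l) z))\<^sup>2) / 2 + (norm (frame_perp l z))\<^sup>2"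
proof -
  define a b q where "a = bil l z / 2" "b = bil (cnj_vec l) z / 2" "q = frame_perp l z"
  have q: "bil l q = 0" "bil (cnj_vec l) q = 0" "bil q l = 0" "bil q (cnj_vec l) = 0"
    using bil_frame_perp[of z] by (auto simp: a_b_q_def bil_commute[of "frame_perp l z"])
  have q': "bil l (cnj_vec q) = 0" "bil (cnj_vec l) (cnj_vec q) = 0"
    using q cnj_bil[of l q] cnj_bil[of "cnj_vec l" q] by auto
  have z: "z = a *s cnj_vec l + b *s l + q"
    using frame_decomp[of z] by (simp add: a_b_q_def)
  have cz: "cnj_vec z = cnj a *s l + cnj b *s cnj_vec l + cnj_vec q"
    by (subst z) simp
  have "of_real ((norm z)\<^sup>2) = bil z (cnj_vec z)" by (simp only: bil_cnj_vec)
  also have "\<dots> = bil (a *s cnj_vec l + b *s l + q) (cnj a *s l + cnj b *s cnj_vec l + cnj_vec q)"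
    using arg_cong2[OF z cz, of bil] .
  also have "\<dots> = 2 * (a * cnj a) + 2 * (b * cnj b) + bil q (cnj_vec q)"
    by (simp add: bil_simps frame_bil q q')
  also have "\<dots> = of_real (2 * (cmod a)\<^sup>2 + 2 * (cmod b)\<^sup>2 + (norm q)\<^sup>2)"
    by (simp only: of_real_add of_real_mult complex_norm_square bil_cnj_vec) simp
  finally have "(norm z)\<^sup>2 = 2 * (cmod a)\<^sup>2 + 2 * (cmod b)\<^sup>2 + (norm q)\<^sup>2"
    using of_real_eq_iff by blast
  then show ?thesis by (simp add: a_b_q_def norm_divide power_divide)
qed

text \<open>Only the case that the left side exceeds \<open>(norm z)\<^sup>2\<close> needs work. Let
  S and T be the squared moduli of the two frame coordinates and Q the squared norm of the
  orthogonal part. Isolating the root and squaring leaves |bil z z|^2 <= S T + 2 Q S. The triangle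
  inequality bounds the left side by (sqrt(S T) + Q)^2, and the case assumption T + 2 Q <= S absorbs
  its cross term.\<close>

lemma bil_frame_le_lie2: "(cmod (bil l z))\<^sup>2 \<le> lie2 z"
proof (cases "(cmod (bil l z))\<^sup>2 \<le> (norm z)\<^sup>2")
  case True
  then show ?thesis by (rule order_trans[OF _ norm2_le_lie2])
next
  case False
  define s t Q where "s = cmod (bil l z)" "t = cmod (bil (cnj_vec l) z)" "Q = (norm (frame_perp l z))\<^sup>2"
  have nz: "(norm z)\<^sup>2 = (s\<^sup>2 + t\<^sup>2) / 2 + Q"
    by (simp add: s_t_Q_def norm2_frame_decomp[of z])
  have nn: "s \<ge> 0" "t \<ge> 0" "Q \<ge> 0" by (auto simp: s_t_Q_def)
  have "(norm z)\<^sup>2 < s\<^sup>2" using False unfolding s_t_Q_def not_le .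
  then have st: "t\<^sup>2 + 2 * Q \<le> s\<^sup>2" unfolding nz by (simp add: field_simps)
  have "cmod (bil z z) \<le> s * t + cmod (bil (frame_perp l z) (frame_perp l z))"
    unfolding s_t_Q_def norm_mult[symmetric] by (subst bil_frame_decomp) (rule norm_triangle_ineq)
  also have "\<dots> \<le> s * t + Q"
    using norm_bil_le[of "frame_perp l z" "frame_perp l z"] by (simp add: s_t_Q_def power2_eq_square)
  finally have "(cmod (bil z z))\<^sup>2 \<le> (s * t + Q)\<^sup>2" by (intro power_mono) auto
  also have "\<dots> = s\<^sup>2 * t\<^sup>2 + Q * (2 * s * t + Q)"
    by (simp add: power2_eq_square algebra_simps)
  also have "\<dots> \<le> s\<^sup>2 * t\<^sup>2 + Q * (2 * s\<^sup>2)"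
    using sum_squares_bound[of s t] st nn by (intro add_left_mono mult_left_mono) auto
  finally have bz: "(cmod (bil z z))\<^sup>2 \<le> s\<^sup>2 * t\<^sup>2 + Q * (2 * s\<^sup>2)" .
  have "(S - ((S + T) / 2 + Q))\<^sup>2 = ((S + T) / 2 + Q)\<^sup>2 - (S * T + Q * (2 * S))" for S T Q :: real
    by (simp add: power2_eq_square field_simps)
  from this[of "s\<^sup>2" "t\<^sup>2" Q] bz
  have "(s\<^sup>2 - (norm z)\<^sup>2)\<^sup>2 \<le> ((norm z)\<^sup>2)\<^sup>2 - (cmod (bil z z))\<^sup>2"
    unfolding nz by linarith
  then have "(s\<^sup>2 - (norm z)\<^sup>2)\<^sup>2 \<le> (norm z)^4 - (cmod (bil z z))\<^sup>2" by simp
  then have "s\<^sup>2 - (norm z)\<^sup>2 \<le> sqrt ((norm z)^4 - (cmod (bil z z))\<^sup>2)"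
    by (rule real_le_rsqrt)
  then show ?thesis by (simp add: lie2_def s_t_Q_def)
qed

text \<open>The error term is quadratic in \<open>frame_perp l z\<close>, not linear as the triangle inequality would give.\<close>

lemma lie2_le_frame:
  fixes z
  defines "a \<equiv> (cmod (bil l z))\<^sup>2" and "b \<equiv> (cmod (bil (cnj_vec l) z))\<^sup>2"
    and "Q \<equiv> (norm (frame_perp l z))\<^sup>2"
  assumes "b < a"
  shows "lie2 z \<le> a + Q * (1 + (2 * (a + b) + Q) / (a - b))"
proof -
  define s t where "s = cmod (bil l z)" "t = cmod (bil (cnj_vec l) z)"
  have nz: "(norm z)\<^sup>2 = (s\<^sup>2 + t\<^sup>2) / 2 + Q"
    by (simp add: s_t_def Q_def norm2_frame_decomp[of z])
  have ab: "a = s\<^sup>2" "b = t\<^sup>2" by (auto simp: s_t_def a_def b_def)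
  have nn: "s \<ge> 0" "t \<ge> 0" "Q \<ge> 0" by (auto simp: s_t_def Q_def)
  define p where "p = cmod (bil (frame_perp l z) (frame_perp l z))"
  have p: "0 \<le> p" "p \<le> Q"
    using norm_bil_le[of "frame_perp l z" "frame_perp l z"] by (auto simp: p_def Q_def power2_eq_square)
  \<comment> \<open>A lower bound of \<open>cmod (bil z z)\<close> bounds the root from above. The
    cross term \<open>s * t * p\<close> is already quadratic in \<open>frame_perp l z\<close>, since
    \<open>p \<le> Q\<close>.\<close>
  have "\<bar>s * t - p\<bar> \<le> cmod (bil z z)"
    unfolding bil_frame_decomp[of z] p_def s_t_def norm_mult[symmetric]
    using norm_triangle_ineq3[of "bil l z * bil (cnj_vec l) z" "- bil (frame_perp l z) (frame_perp l z)"]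
    by simp
  then have "(s * t - p)\<^sup>2 \<le> (cmod (bil z z))\<^sup>2"
    by (metis abs_ge_zero power2_abs power_mono)
  moreover have "s * t * p \<le> s * t * Q" by (intro mult_left_mono p) (use nn in auto)
  moreover have "(s * t - p)\<^sup>2 = s\<^sup>2 * t\<^sup>2 - 2 * (s * t * p) + p\<^sup>2"
    by (simp add: power2_eq_square algebra_simps)
  ultimately have "s\<^sup>2 * t\<^sup>2 - 2 * (s * t * Q) \<le> (cmod (bil z z))\<^sup>2"
    using zero_le_power2[of p] by linarith
  moreover have "2 * (s * t) * Q \<le> (a + b) * Q"
    unfolding ab using sum_squares_bound[of s t] nn by (intro mult_right_mono) auto
  ultimately have *: "a * b - (a + b) * Q \<le> (cmod (bil z z))\<^sup>2" unfolding ab by linarith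
  define d where "d = a - b"
  have d: "d > 0" using assms by (simp add: d_def)
  \<comment> \<open>The radicand is at most \<open>(d / 2)\<^sup>2 + R * d\<close>, and adding
    \<open>R\<^sup>2\<close> completes the square. Dividing by the gap \<open>d\<close> keeps the
    result linear in \<open>Q\<close>, where the root alone would give order \<open>sqrt Q\<close>
    at \<open>d = 0\<close>.\<close>
  define R where "R = Q * (2 * (a + b) + Q) / d"
  have Rd: "R * d = Q * (2 * (a + b) + Q)" using d by (simp add: R_def)
  have "(norm z)^4 = ((norm z)\<^sup>2)\<^sup>2" by simp
  also have "\<dots> = ((a + b) / 2 + Q)\<^sup>2" by (simp add: nz ab)
  finally have "(norm z)^4 - (cmod (bil z z))\<^sup>2 \<le> ((a + b) / 2 + Q)\<^sup>2 - (a * b - (a + b) * Q)"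
    using * by linarith
  also have "\<dots> = (d / 2)\<^sup>2 + R * d"
    unfolding Rd by (simp add: d_def power2_eq_square field_simps)
  also have "\<dots> \<le> (d / 2 + R)\<^sup>2" by (simp add: power2_eq_square algebra_simps)
  finally have "sqrt ((norm z)^4 - (cmod (bil z z))\<^sup>2) \<le> d / 2 + R"
    using d nn assms(4) by (intro real_le_lsqrt add_nonneg_nonneg) (auto simp: R_def ab)
  then have "lie2 z \<le> (a + b) / 2 + Q + (d / 2 + R)"
    unfolding lie2_def nz ab by linarith
  also have "\<dots> = a + Q * (1 + (2 * (a + b) + Q) / (a - b))"
    by (simp add: d_def R_def field_simps)
  finally show ?thesis .
qed

end

section \<open>Frames adapted to a point\<close>

lemma exists_orthonormal_pair:
  fixes x y :: "real^'m::finite"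
  assumes "CARD('m) \<ge> 2" "x \<bullet> y = 0" "norm y \<le> norm x"
  obtains e f where "norm e = 1" "norm f = 1" "e \<bullet> f = 0" "x = norm x *\<^sub>R e" "y = norm y *\<^sub>R f"
proof -
  obtain e :: "real^'m" where e: "norm e = 1" "x = norm x *\<^sub>R e"
  proof (cases "x = 0")
    case True
    then show ?thesis using that[of "axis undefined 1"] by (simp add: norm_axis_1)
  next
    case False
    then show ?thesis using that[of "x /\<^sub>R norm x"] by simp
  qed
  show ?thesis
  \<comment> \<open>For \<open>y = 0\<close> the second dimension leaves room for \<open>f\<close>.
    For \<open>y \<noteq> 0\<close> the inequality of the norms forces \<open>x \<noteq> 0\<close>,
    so \<open>e\<close> is the direction of \<open>x\<close> and is orthogonal to
    \<open>y\<close>.\<close>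
  proof (cases "y = 0")
    case True
    have "2 \<le> DIM(real^'m)" using assms(1) by simp
    then obtain f where f: "f \<noteq> 0" "orthogonal e f"
      by (rule orthogonal_to_vector_exists)
    then show ?thesis using e True
      by (intro that[of e "f /\<^sub>R norm f"]) (auto simp: orthogonal_def)
  next
    case False
    then have "x \<noteq> 0" using assms(3) by auto
    have "x \<bullet> y = norm x * (e \<bullet> y)" by (subst e(2)) simp
    then have "e \<bullet> y = 0" using \<open>x \<noteq> 0\<close> assms(2) by simp
    then show ?thesis using e False
      by (intro that[of e "y /\<^sub>R norm y"]) auto
  qed
qed

definition cvec :: "real^'m::finite \<Rightarrow> complex^'m" where
  "cvec x = (\<chi> i. of_real (x $ i))"

lemma cvec_simps [simp]:
  "cnj_vec (cvec x) = cvec x" "cvec (r *\<^sub>R x) = of_real r *s cvec x"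
  "bil (cvec x) (cvec y) = of_real (x \<bullet> y)"
  by (simp_all add: cvec_def cnj_vec_def vec_eq_iff bil_def inner_vec_def)

lemma exists_unit_rotation: "\<exists>m. cmod m = 1 \<and> m\<^sup>2 * c = of_real (cmod c)"
proof (cases "c = 0")
  case False
  define m where "m = csqrt (cnj c / of_real (cmod c))"
  have m: "m\<^sup>2 = cnj c / of_real (cmod c)" by (simp add: m_def)
  then have "(cmod m)\<^sup>2 = 1" using False by (metis complex_mod_cnj divide_self norm_divide norm_eq_zero norm_of_real norm_power abs_norm_cancel)
  then have "cmod m = 1" using power2_eq_1_iff norm_ge_zero by (metis abs_norm_cancel abs_1 power2_eq_iff_nonneg one_power2 zero_le_one)
  moreover have "m\<^sup>2 * c = of_real (cmod c)"
    using False unfolding m by (simp add: complex_norm_square[symmetric] mult.commute[of "cnj c"] power2_eq_square)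
  ultimately show ?thesis by blast
qed (auto intro: exI[of _ 1])

text \<open>Rotating \<open>z\<close> by a unit scalar makes its real and imaginary parts orthogonal.\<close>

lemma exists_adapted_frame:
  fixes z :: "complex^'m::finite"
  assumes card: "CARD('m) \<ge> 2"
  obtains l where "isotropic_frame l" "frame_perp l z = 0"
    "cmod (bil (cnj_vec l) z) \<le> cmod (bil l z)"
    "z \<notin> CR \<Longrightarrow> cmod (bil (cnj_vec l) z) < cmod (bil l z)"
proof -
  obtain m where m: "cmod m = 1" "m\<^sup>2 * bil z z = of_real (cmod (bil z z))"
    using exists_unit_rotation by blast
  have m0: "m \<noteq> 0" using m(1) by auto
  define x y :: "real^'m" where "x = (\<chi> i. Re (m * z $ i))" and "y = (\<chi> i. Im (m * z $ i))"
  have mz: "m *s z = cvec x + \<i> *s cvec y"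
    by (simp add: vec_eq_iff cvec_def x_def y_def complex_eq_iff)
  have "of_real (cmod (bil z z)) = bil (m *s z) (m *s z)"
    using m(2) by (simp add: bil_simps power2_eq_square mult_ac)
  also have "\<dots> = of_real (x \<bullet> x - y \<bullet> y) + \<i> * of_real (2 * (x \<bullet> y))"
    unfolding mz by (simp add: bil_simps algebra_simps inner_commute)
  finally have eq: "of_real (cmod (bil z z)) = of_real (x \<bullet> x - y \<bullet> y) + \<i> * of_real (2 * (x \<bullet> y))" .
  \<comment> \<open>After the rotation \<open>bil (m *s z) (m *s z)\<close> is real and nonnegative:
    its imaginary part yields orthogonality, its real part the order of the norms.\<close>
  have "x \<bullet> y = 0" using arg_cong[OF eq, of Im] by simp
  moreover have "norm y \<le> norm x"
    using arg_cong[OF eq, of Re] norm_ge_zero[of "bil z z"] by (simp add: norm_eq_sqrt_inner)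
  ultimately obtain e f where ef: "norm e = 1" "norm f = 1" "e \<bullet> f = 0"
      and x: "x = norm x *\<^sub>R e" and y: "y = norm y *\<^sub>R f"
    using exists_orthonormal_pair[OF card] by blast
  \<comment> \<open>With this sign \<open>bil l\<close> adds the two lengths at
    \<open>m *s z\<close> and the conjugate form subtracts them. Equality would mean
    \<open>y = 0\<close>, hence a real vector \<open>m *s z\<close> and
    \<open>z \<in> CR\<close>.\<close>
  define l where "l = cvec e - \<i> *s cvec f"
  have ee: "e \<bullet> e = 1" "f \<bullet> f = 1" "f \<bullet> e = 0"
    using ef by (simp_all add: norm_eq_1 inner_commute)
  have "bil l (cnj_vec l) = 2"
    by (simp add: l_def bil_simps ee ef)
  then have "of_real ((norm l)\<^sup>2) = (of_real 2 :: complex)" unfolding bil_cnj_vec by simp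
  then have "(norm l)\<^sup>2 = 2" by (simp only: of_real_eq_iff)
  then have l: "isotropic_frame l"
    by (simp add: isotropic_frame_def) (simp add: l_def bil_simps ee ef)
  have mz': "m *s z = of_real (norm x) *s cvec e + (\<i> * of_real (norm y)) *s cvec f"
    by (subst mz, subst x, subst y) (simp add: vec_eq_iff)
  have s: "bil l (m *s z) = of_real (norm x + norm y)"
    unfolding mz' by (simp add: l_def bil_simps ee ef complex_eq_iff)
  have t: "bil (cnj_vec l) (m *s z) = of_real (norm x - norm y)"
    unfolding mz' by (simp add: l_def bil_simps ee ef complex_eq_iff)
  have "frame_perp l (m *s z) = 0"
    unfolding frame_perp_def s t unfolding mz' l_def by (simp add: vec_eq_iff field_simps)
  then have "frame_perp l z = 0" using m0 by (simp add: frame_perp_simps)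
  moreover have st: "cmod (bil l z) = norm x + norm y" "cmod (bil (cnj_vec l) z) = norm x - norm y"
    using arg_cong[OF s, of cmod] arg_cong[OF t, of cmod] m(1) \<open>norm y \<le> norm x\<close>
    by (simp_all add: bil_simps norm_mult del: of_real_add of_real_diff)
  moreover have "y \<noteq> 0" if "z \<notin> CR"
  proof
    assume "y = 0"
    then have "z = (1 / m) *s cvec x"
      using mz m0 by (simp add: vec_eq_iff cvec_def field_simps)
    then show False using that unfolding CR_def cvec_def by blast
  qed
  ultimately show ?thesis using l by (intro that[of l]) auto
qed

text \<open>Without an orthogonal part the radicand is the square of half the difference of the
  squared frame coordinates, so the bound \<open>bil_frame_le_lie2\<close> is attained.\<close>

lemma lie2_adapted_frame:
  assumes "isotropic_frame l" "frame_perp l z = 0" "cmod (bil (cnj_vec l) z) \<le> cmod (bil l z)"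
  shows "lie2 z = (cmod (bil l z))\<^sup>2"
proof -
  define s t where "s = cmod (bil l z)" "t = cmod (bil (cnj_vec l) z)"
  have nz: "(norm z)\<^sup>2 = (s\<^sup>2 + t\<^sup>2) / 2"
    using norm2_frame_decomp[OF assms(1), of z] by (simp add: s_t_def assms(2))
  have bz: "cmod (bil z z) = s * t"
    using bil_frame_decomp[OF assms(1), of z] by (simp add: s_t_def assms(2) norm_mult bil_def)
  have "t\<^sup>2 \<le> s\<^sup>2" using assms(3) by (simp add: s_t_def power_mono)
  have "(norm z)^4 - (cmod (bil z z))\<^sup>2 = ((norm z)\<^sup>2)\<^sup>2 - (s * t)\<^sup>2" by (simp add: bz)
  also have "\<dots> = ((s\<^sup>2 - t\<^sup>2) / 2)\<^sup>2"
    unfolding nz by (simp add: power2_eq_square field_simps)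
  finally have "lie2 z = (s\<^sup>2 + t\<^sup>2) / 2 + (s\<^sup>2 - t\<^sup>2) / 2"
    using \<open>t\<^sup>2 \<le> s\<^sup>2\<close> unfolding lie2_def nz by simp
  then show ?thesis by (simp add: s_t_def field_simps)
qed

section \<open>Charts and tangent vectors\<close>

definition holomorphic_vec_on :: "(complex^'n::finite \<Rightarrow> complex^'m::finite) \<Rightarrow> (complex^'n) set \<Rightarrow> bool" where
  "holomorphic_vec_on F S \<longleftrightarrow> (\<forall>i. holomorphic_fun_on (\<lambda>x. F x $ i) S)"

lemma norm_vec_scale: "norm (c *s v) = cmod c * norm v" for v :: "complex^'n::finite"
  by (simp add: norm_vec_def norm_mult L2_set_right_distrib)

lemma has_derivative_vec_components:
  fixes F :: "'a::real_normed_vector \<Rightarrow> complex^'m::finite"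
  assumes "\<And>i. ((\<lambda>x. F x $ i) has_derivative f i) net"
  shows "(F has_derivative (\<lambda>h. \<chi> i. f i h)) net"
proof -
  have bl: "bounded_linear (axis i :: complex \<Rightarrow> complex^'m)" for i
    by (rule linear_conv_bounded_linear[THEN iffD1], unfold_locales) (auto simp: vec_eq_iff axis_def)
  have eq: "(\<Sum>i\<in>UNIV. axis i (y i)) = (\<chi> i. y i)" for y :: "'m \<Rightarrow> complex"
    by (auto simp: vec_eq_iff axis_def sum.delta' sum.delta if_distrib cong: if_cong)
  have "((\<lambda>x. \<Sum>i\<in>UNIV. axis i (F x $ i)) has_derivative (\<lambda>h. \<Sum>i\<in>UNIV. axis i (f i h))) net"
    by (intro has_derivative_sum bounded_linear.has_derivative[OF bl] assms)
  then show ?thesis by (simp add: eq)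
qed

text \<open>Holomorphy is given component by component; uniqueness of the Frechet derivative
  identifies the assembled components with \<open>frechet_derivative\<close>, which thus inherits
  complex linearity.\<close>

lemma holomorphic_vec_onD:
  assumes "holomorphic_vec_on F S" "x \<in> S"
  shows "(F has_derivative frechet_derivative F (at x)) (at x)"
    and "Vector_Spaces.linear (*s) (*s) (frechet_derivative F (at x))"
proof -
  have "\<forall>i. \<exists>f'. ((\<lambda>x. F x $ i) has_derivative f') (at x) \<and> Vector_Spaces.linear (*s) (*) f'"
    using assms unfolding holomorphic_vec_on_def holomorphic_fun_on_def by blast
  from choice[OF this] obtain f where f: "\<And>i. ((\<lambda>x. F x $ i) has_derivative f i) (at x)"
      "\<And>i. Vector_Spaces.linear (*s) (*) (f i)"
    by blast
  have *: "(F has_derivative (\<lambda>h. \<chi> i. f i h)) (at x)"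
    by (rule has_derivative_vec_components) (rule f)
  then have eq: "frechet_derivative F (at x) = (\<lambda>h. \<chi> i. f i h)"
    by (rule frechet_derivative_at[symmetric])
  show "(F has_derivative frechet_derivative F (at x)) (at x)" using * eq by simp
  have "f i (u + v) = f i u + f i v" "f i (c *s v) = c * f i v" for i u v c
    using f(2)[of i] by (simp_all add: Vector_Spaces.linear_iff)
  then show "Vector_Spaces.linear (*s) (*s) (frechet_derivative F (at x))"
    unfolding eq by (simp add: Vector_Spaces.linear_iff vec_eq_iff vec.vector_space_axioms)
qed

lemma holomorphic_vec_on_continuous:
  "holomorphic_vec_on F S \<Longrightarrow> continuous_on S F"
  by (intro continuous_at_imp_continuous_on ballI has_derivative_continuous[OF holomorphic_vec_onD(1)])

lemma frechet_derivative_scale: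
  assumes "holomorphic_vec_on F S" "x \<in> S"
  shows "frechet_derivative F (at x) (c *s v) = c *s frechet_derivative F (at x) v"
  using holomorphic_vec_onD(2)[OF assms] by (simp add: Vector_Spaces.linear_iff)

section \<open>Restriction to complex lines\<close>

lemma has_derivative_complex_line:
  "((\<lambda>\<zeta>. a + \<zeta> *s v) has_derivative (\<lambda>\<zeta>. \<zeta> *s v)) (at z)" for v :: "complex^'n::finite"
proof -
  have "((\<lambda>\<zeta>. \<zeta> *s v) has_derivative (\<lambda>h. \<chi> i. h * v $ i)) (at z)"
    by (rule has_derivative_vec_components) (auto intro!: derivative_eq_intros)
  then have "((\<lambda>\<zeta>. \<zeta> *s v) has_derivative (\<lambda>\<zeta>. \<zeta> *s v)) (at z)"
    by (simp add: vector_scalar_mult_def)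
  from has_derivative_add[OF has_derivative_const[of a] this] show ?thesis by simp
qed

lemma has_field_derivative_complex_line:
  assumes F: "holomorphic_vec_on F S" and "a + z *s v \<in> S"
  shows "((\<lambda>\<zeta>. F (a + \<zeta> *s v) $ i) has_field_derivative
           frechet_derivative F (at (a + z *s v)) v $ i) (at z)"
proof -
  let ?D = "frechet_derivative F (at (a + z *s v))"
  have "((\<lambda>\<zeta>. F (a + \<zeta> *s v)) has_derivative (\<lambda>\<zeta>. ?D (\<zeta> *s v))) (at z)"
    by (rule has_derivative_compose[OF has_derivative_complex_line holomorphic_vec_onD(1)[OF assms]])
  from bounded_linear.has_derivative[OF bounded_linear_vec_nth this, of i]
  show ?thesis
    unfolding has_field_derivative_def frechet_derivative_scale[OF assms] by (simp add: mult_commute_abs)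
qed

lemma complex_line_holomorphic:
  assumes "holomorphic_vec_on F S"
  shows "(\<lambda>\<zeta>. F (a + \<zeta> *s v) $ i) holomorphic_on {\<zeta>. a + \<zeta> *s v \<in> S}"
proof (rule holomorphic_onI)
  fix \<zeta> assume "\<zeta> \<in> {\<zeta>. a + \<zeta> *s v \<in> S}"
  then have "a + \<zeta> *s v \<in> S" by simp
  from has_field_derivative_at_within[OF has_field_derivative_complex_line[OF assms this]]
  show "(\<lambda>\<zeta>. F (a + \<zeta> *s v) $ i) field_differentiable at \<zeta> within {\<zeta>. a + \<zeta> *s v \<in> S}"
    unfolding field_differentiable_def by (rule exI)
qed

lemma continuous_on_complex_line: "continuous_on S (\<lambda>\<zeta>. a + \<zeta> *s v)" for v :: "complex^'n::finite"
  by (intro continuous_at_imp_continuous_on ballI has_derivative_continuous[OF has_derivative_complex_line])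

lemma open_complex_line: "open S \<Longrightarrow> open {\<zeta>. a + \<zeta> *s v \<in> S}" for v :: "complex^'n::finite"
  using open_vimage[OF _ continuous_on_complex_line[of UNIV a v]] by (simp add: vimage_def)

text \<open>Unlike \<open>differential\<close>, this names its chart. Taking another chart map for
  \<open>G\<close> gives the derivative of a transition map, so \<open>tangent_space\<close> and
  \<open>differential\<close> can both be expressed through it.\<close>

definition chart_deriv ::
    "'a set \<Rightarrow> ('a \<Rightarrow> complex^'n::finite) \<Rightarrow> ('a \<Rightarrow> complex^'m::finite) \<Rightarrow> 'a \<Rightarrow> complex^'n \<Rightarrow> complex^'m" where
  "chart_deriv U \<phi> G x = frechet_derivative (G \<circ> inv_into U \<phi>) (at (\<phi> x))"

lemma holomorphic_map_in_chart:
  "holomorphic_map A F \<Longrightarrow> (U, \<phi>) \<in> A \<Longrightarrow> holomorphic_vec_on (F \<circ> inv_into U \<phi>) (\<phi> ` U)"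
  by (auto simp: holomorphic_map_def holomorphic_fun_def holomorphic_vec_on_def o_def)

context
  fixes A :: "('a::{t2_space,second_countable_topology}, 'n::finite) chart set"
  assumes atlas: "complex_atlas A"
begin

lemma atlas_cover: "\<exists>U \<phi>. (U, \<phi>) \<in> charts_at A x"
proof -
  have "(\<Union>(U, \<phi>)\<in>A. U) = UNIV" using atlas unfolding complex_atlas_def by (elim conjE)
  then have "x \<in> (\<Union>(U, \<phi>)\<in>A. U)" by simp
  then show ?thesis by (auto simp: charts_at_def)
qed

lemma chart_facts:
  assumes "(U, \<phi>) \<in> A"
  shows "open U" "open (\<phi> ` U)" "homeomorphism U (\<phi> ` U) \<phi> (inv_into U \<phi>)"
    and "continuous_on U \<phi>" "continuous_on (\<phi> ` U) (inv_into U \<phi>)"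
    and "\<And>x. x \<in> U \<Longrightarrow> inv_into U \<phi> (\<phi> x) = x"
proof -
  show "open U" "open (\<phi> ` U)" and hom: "homeomorphism U (\<phi> ` U) \<phi> (inv_into U \<phi>)"
    using atlas assms unfolding complex_atlas_def by blast+
  from hom show "continuous_on U \<phi>" "continuous_on (\<phi> ` U) (inv_into U \<phi>)"
      "\<And>x. x \<in> U \<Longrightarrow> inv_into U \<phi> (\<phi> x) = x"
    by (auto simp: homeomorphism_def)
qed

lemma open_chart_image:
  assumes "(U, \<phi>) \<in> A" "open W"
  shows "open (\<phi> ` (U \<inter> W))"
proof -
  have "openin (top_of_set (\<phi> ` U)) (\<phi> ` (U \<inter> W))"
    using chart_facts(3)[OF assms(1)] homeomorphism_imp_open_map assms(2) openin_open by blast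
  then show ?thesis using chart_facts(2)[OF assms(1)] openin_open_trans by blast
qed

lemma transition_holomorphic:
  "(U, \<phi>) \<in> A \<Longrightarrow> (V, \<psi>) \<in> A \<Longrightarrow> holomorphic_vec_on (\<psi> \<circ> inv_into U \<phi>) (\<phi> ` (U \<inter> V))"
  using atlas unfolding complex_atlas_def holomorphic_vec_on_def by fastforce

lemma transition_has_derivative:
  assumes "(U, \<phi>) \<in> A" "(V, \<psi>) \<in> A" "x \<in> U" "x \<in> V"
  shows "((\<psi> \<circ> inv_into U \<phi>) has_derivative chart_deriv U \<phi> \<psi> x) (at (\<phi> x))"
  unfolding chart_deriv_def
  by (rule holomorphic_vec_onD(1)[OF transition_holomorphic[OF assms(1,2)]]) (use assms in auto)

lemma chart_deriv_chain:
  assumes "(U, \<phi>) \<in> A" "(V, \<psi>) \<in> A" "x \<in> U" "x \<in> V"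
    and G: "((G \<circ> inv_into V \<psi>) has_derivative chart_deriv V \<psi> G x) (at (\<psi> x))"
  shows "chart_deriv U \<phi> G x v = chart_deriv V \<psi> G x (chart_deriv U \<phi> \<psi> x v)"
proof -
  have "((G \<circ> inv_into V \<psi>) has_derivative chart_deriv V \<psi> G x) (at ((\<psi> \<circ> inv_into U \<phi>) (\<phi> x)))"
    using G chart_facts(6)[OF assms(1,3)] by simp
  from diff_chain_at[OF transition_has_derivative[OF assms(1-4)] this]
  have "((G \<circ> inv_into U \<phi>) has_derivative chart_deriv V \<psi> G x \<circ> chart_deriv U \<phi> \<psi> x) (at (\<phi> x))"
  proof (rule has_derivative_transform_within_open)
    show "open (\<phi> ` (U \<inter> V))"
      by (rule open_chart_image[OF assms(1) chart_facts(1)[OF assms(2)]])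
    show "\<phi> x \<in> \<phi> ` (U \<inter> V)" using assms by auto
  qed (auto simp: chart_facts(6)[OF assms(1)] chart_facts(6)[OF assms(2)])
  from frechet_derivative_at[OF this, symmetric] show ?thesis by (simp add: chart_deriv_def)
qed

lemma chart_deriv_self:
  assumes "(U, \<phi>) \<in> A" "x \<in> U"
  shows "chart_deriv U \<phi> \<phi> x v = v"
proof -
  have "((\<lambda>y. y) has_derivative (\<lambda>h. h)) (at (\<phi> x))" by (rule has_derivative_ident)
  then have "((\<phi> \<circ> inv_into U \<phi>) has_derivative (\<lambda>h. h)) (at (\<phi> x))"
    by (rule has_derivative_transform_within_open[OF _ chart_facts(2)[OF assms(1)]])
       (use assms chart_facts(6)[OF assms(1)] in auto)
  from frechet_derivative_at[OF this, symmetric] show ?thesis by (simp add: chart_deriv_def)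
qed

lemma holomorphic_map_has_derivative:
  assumes "holomorphic_map A F" "(U, \<phi>) \<in> A" "x \<in> U"
  shows "((F \<circ> inv_into U \<phi>) has_derivative chart_deriv U \<phi> F x) (at (\<phi> x))"
  unfolding chart_deriv_def
  by (rule holomorphic_vec_onD(1)[OF holomorphic_map_in_chart[OF assms(1,2)]]) (use assms in auto)

lemma holomorphic_map_continuous:
  assumes "holomorphic_map A F"
  shows "continuous_on UNIV F"
proof (rule continuous_at_imp_continuous_on, rule ballI)
  fix x
  obtain U \<phi> where U: "(U, \<phi>) \<in> A" "x \<in> U" using atlas_cover[of x] by (auto simp: charts_at_def)
  have "continuous_on (\<phi> ` U) (F \<circ> inv_into U \<phi>)"
    by (rule continuous_at_imp_continuous_on)
       (use holomorphic_map_has_derivative[OF assms U(1)] has_derivative_continuous in blast)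
  then have "continuous_on U ((F \<circ> inv_into U \<phi>) \<circ> \<phi>)"
    by (rule continuous_on_compose[OF chart_facts(4)[OF U(1)]])
  then have "continuous_on U F"
    by (rule continuous_on_eq) (use chart_facts(6)[OF U(1)] in auto)
  then show "isCont F x" using U chart_facts(1)[OF U(1)] by (simp add: continuous_on_eq_continuous_at)
qed

lemma tangent_space_iff:
  "w \<in> tangent_space A z \<longleftrightarrow> (\<forall>c. c \<notin> charts_at A z \<longrightarrow> w c = 0) \<and>
     (\<forall>U \<phi> V \<psi>. (U, \<phi>) \<in> charts_at A z \<longrightarrow> (V, \<psi>) \<in> charts_at A z
        \<longrightarrow> w (V, \<psi>) = chart_deriv U \<phi> \<psi> z (w (U, \<phi>)))"
  by (simp add: tangent_space_def chart_deriv_def Ball_def)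

text \<open>Transition derivatives are linear, so one vanishing coordinate vector makes the whole
  family vanish. This turns the tangent vectors of part (ii) into nonzero coordinate
  vectors.\<close>

lemma tangent_vector_nonzero:
  assumes w: "w \<in> tangent_space A z" "w \<noteq> (\<lambda>_. 0)" and U: "(U, \<phi>) \<in> charts_at A z"
  shows "w (U, \<phi>) \<noteq> 0"
proof
  assume 0: "w (U, \<phi>) = 0"
  have "w c = 0" for c
  proof (cases "c \<in> charts_at A z")
    case True
    obtain V \<psi> where c: "c = (V, \<psi>)" by (cases c)
    have "w (V, \<psi>) = chart_deriv U \<phi> \<psi> z (w (U, \<phi>))"
      using w(1) U True unfolding c tangent_space_iff by metis
    also have "\<dots> = 0"
      unfolding 0 using linear_0[OF has_derivative_linear[OF transition_has_derivative[of U \<phi> V \<psi> z]]]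
        U True by (simp add: c charts_at_def)
    finally show ?thesis by (simp add: c)
  qed (use w(1) tangent_space_iff in blast)
  with w(2) show False by blast
qed

text \<open>Serves to carry injectivity on \<open>tangent_space\<close> over to a coordinate
  derivative; compatibility of the family is the chain rule.\<close>

lemma tangent_vector_exists:
  assumes U: "(U, \<phi>) \<in> charts_at A z"
  obtains w where "w \<in> tangent_space A z" "w (U, \<phi>) = v"
proof -
  define w where "w c = (if c \<in> charts_at A z then chart_deriv U \<phi> (snd c) z v else 0)" for c
  have trans: "w (V', \<psi>') = chart_deriv V \<psi> \<psi>' z (w (V, \<psi>))"
    if "(V, \<psi>) \<in> charts_at A z" "(V', \<psi>') \<in> charts_at A z" for V \<psi> V' \<psi>'
  proof -
    have A: "(U, \<phi>) \<in> A" "(V, \<psi>) \<in> A" "(V', \<psi>') \<in> A" "z \<in> U" "z \<in> V" "z \<in> V'"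
      using that U by (auto simp: charts_at_def)
    show ?thesis
      using chart_deriv_chain[OF A(1,2,4,5) transition_has_derivative[OF A(2,3,5,6)]] that
      by (simp add: w_def)
  qed
  have "w \<in> tangent_space A z"
    unfolding tangent_space_iff
  proof (intro conjI allI impI)
    show "w c = 0" if "c \<notin> charts_at A z" for c using that by (simp add: w_def)
  qed (rule trans)
  moreover have "w (U, \<phi>) = v"
    using U by (auto simp: w_def charts_at_def chart_deriv_self)
  ultimately show ?thesis by (rule that)
qed

lemma differential_in_chart:
  obtains U \<phi> where "(U, \<phi>) \<in> charts_at A z"
    "\<And>(F :: 'a \<Rightarrow> complex^'m::finite) w. differential A F z w = chart_deriv U \<phi> F z (w (U, \<phi>))"
proof -
  obtain U \<phi> where c: "(SOME c. c \<in> charts_at A z) = (U, \<phi>)" by (cases "SOME c. c \<in> charts_at A z")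
  have "(SOME c. c \<in> charts_at A z) \<in> charts_at A z"
    using atlas_cover[of z] someI_ex[of "\<lambda>c. c \<in> charts_at A z"] by blast
  then show ?thesis
    by (intro that[of U \<phi>]) (simp_all add: c differential_def chart_deriv_def)
qed

text \<open>Cauchy's inequality along complex lines shows that injectivity of the derivative is an open
  condition, without continuity of the derivative.\<close>

lemma holomorphic_immersion_open:
  fixes F :: "'a \<Rightarrow> complex^'m::finite"
  assumes F: "holomorphic_map A F" and inj: "inj_on (differential A F z) (tangent_space A z)"
  obtains W where "open W" "z \<in> W"
    "\<And>p U \<phi> v. p \<in> W \<Longrightarrow> (U, \<phi>) \<in> charts_at A p \<Longrightarrow> v \<noteq> 0 \<Longrightarrow> chart_deriv U \<phi> F p v \<noteq> 0"
proof -
  obtain U \<phi> where U: "(U, \<phi>) \<in> charts_at A z"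
    and diff: "\<And>w. differential A F z w = chart_deriv U \<phi> F z (w (U, \<phi>))"
    using differential_in_chart by metis
  have UA: "(U, \<phi>) \<in> A" "z \<in> U" using U by (auto simp: charts_at_def)
  define G where "G = F \<circ> inv_into U \<phi>"
  define D where "D = chart_deriv U \<phi> F z"
  have holG: "holomorphic_vec_on G (\<phi> ` U)"
    unfolding G_def by (rule holomorphic_map_in_chart[OF F UA(1)])
  have derG: "(G has_derivative D) (at (\<phi> z))"
    unfolding G_def D_def by (rule holomorphic_map_has_derivative[OF F UA])
  have linD: "linear D" using derG by (rule has_derivative_linear)
  have scaleD: "D (c *s v) = c *s D v" for c v
    unfolding D_def chart_deriv_def G_def[symmetric]
    by (rule frechet_derivative_scale[OF holG]) (use UA in auto)
  have "inj D"
  proof (rule injI)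
    fix v v' assume eq: "D v = D v'"
    obtain w w' where "w \<in> tangent_space A z" "w (U, \<phi>) = v" "w' \<in> tangent_space A z" "w' (U, \<phi>) = v'"
      using tangent_vector_exists[OF U] by metis
    then show "v = v'" using inj eq unfolding inj_on_def diff D_def by metis
  qed
  then obtain m where m: "m > 0" "\<And>v. norm (D v) \<ge> m * norm v"
    using linear_inj_bounded_below_pos[OF linD] by metis
  define C where "C = real CARD('m)"
  have C: "C > 0" by (simp add: C_def)
  \<comment> \<open>\<open>C\<close> counts the components; one factor 2 is lost because the disc
    has radius \<open>d / (2 * norm v)\<close>, the other leaves a strict margin below
    \<open>m * norm v\<close>.\<close>
  have "m / (4 * C) > 0" using m C by simp
  then obtain d1 where d1: "d1 > 0"
    "\<And>y. norm (y - \<phi> z) < d1 \<Longrightarrow> norm (G y - G (\<phi> z) - D (y - \<phi> z)) \<le> m / (4 * C) * norm (y - \<phi> z)"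
    using derG unfolding has_derivative_at_alt by blast
  obtain d2 where d2: "d2 > 0" "ball (\<phi> z) d2 \<subseteq> \<phi> ` U"
    using chart_facts(2)[OF UA(1)] UA(2) open_contains_ball by (metis imageI)
  define d where "d = min d1 d2"
  have d: "d > 0" using d1(1) d2(1) by (simp add: d_def)
  have key: "frechet_derivative G (at x) v \<noteq> 0" if x: "dist (\<phi> z) x < d / 2" and v: "v \<noteq> 0" for x v
  proof
    assume 0: "frechet_derivative G (at x) v = 0"
    define R where "R = d / (2 * norm v)"
    have R: "R > 0" using d v by (simp add: R_def)
    \<comment> \<open>The Taylor remainder of \<open>G\<close> at \<open>\<phi> z\<close>, not at
      \<open>x\<close>, along the line through \<open>x\<close>. If the derivative at
      \<open>x\<close> kills \<open>v\<close>, the derivative of the remainder at 0 is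
      \<open>- D v\<close>, whereas its smallness on the circle of radius \<open>R\<close> makes
      that derivative small by Cauchy's inequality.\<close>
    define e where "e = (\<lambda>i \<zeta>. (G (x + \<zeta> *s v) - G (\<phi> z) - D (x + \<zeta> *s v - \<phi> z)) $ i)"
    have near: "norm (x + \<zeta> *s v - \<phi> z) < d" if "cmod \<zeta> \<le> R" for \<zeta>
    proof -
      have "norm (x + \<zeta> *s v - \<phi> z) \<le> norm (x - \<phi> z) + norm (\<zeta> *s v)"
        using norm_triangle_ineq[of "x - \<phi> z" "\<zeta> *s v"] by (simp add: algebra_simps)
      also have "norm (\<zeta> *s v) = cmod \<zeta> * norm v"
        by (rule norm_vec_scale)
      also have "\<dots> \<le> R * norm v" using that by (intro mult_right_mono) auto
      also have "\<dots> = d / 2" using v by (simp add: R_def)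
      finally show ?thesis using x by (simp add: dist_norm norm_minus_commute)
    qed
    have inU: "x + \<zeta> *s v \<in> \<phi> ` U" if "cmod \<zeta> \<le> R" for \<zeta>
      using near[OF that] d2(2) by (auto simp: d_def dist_norm norm_minus_commute subset_iff)
    have ed: "(e i has_field_derivative (frechet_derivative G (at (x + \<zeta> *s v)) v $ i - D v $ i)) (at \<zeta>)"
      if "cmod \<zeta> \<le> R" for \<zeta> i
    proof -
      have "((\<lambda>\<zeta>. G (x + \<zeta> *s v) $ i - G (\<phi> z) $ i - (D (x - \<phi> z) $ i + \<zeta> * D v $ i))
          has_field_derivative (frechet_derivative G (at (x + \<zeta> *s v)) v $ i - 0 - (0 + D v $ i))) (at \<zeta>)"
        by (intro DERIV_diff DERIV_add DERIV_const DERIV_cmult_right[OF DERIV_ident, of "D v $ i", simplified]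
            has_field_derivative_complex_line[OF holG] inU that)
      moreover have "D (x + \<zeta> *s v - \<phi> z) = D (x - \<phi> z) + \<zeta> *s D v" for \<zeta>
        using linear_add[OF linD, of "x - \<phi> z" "\<zeta> *s v"] scaleD[of \<zeta> v] by (simp add: algebra_simps)
      ultimately show ?thesis by (simp add: e_def)
    qed
    have "norm (D v $ i) \<le> m * norm v / (2 * C)" for i
    proof -
      have "norm ((deriv ^^ 1) (e i) 0) \<le> fact 1 * (m / (4 * C) * d) / R ^ 1"
      proof (rule Cauchy_inequality)
        show "e i holomorphic_on ball 0 R"
        proof (rule holomorphic_onI)
          fix \<zeta> :: complex assume "\<zeta> \<in> ball 0 R"
          then have "cmod \<zeta> \<le> R" by simp
          from has_field_derivative_at_within[OF ed[OF this]]
          show "e i field_differentiable at \<zeta> within ball 0 R"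
            unfolding field_differentiable_def by (rule exI)
        qed
        show "continuous_on (cball 0 R) (e i)"
          by (intro continuous_at_imp_continuous_on ballI DERIV_isCont[OF ed]) auto
        fix \<zeta> :: complex assume "norm (0 - \<zeta>) = R"
        then have \<zeta>: "norm (x + \<zeta> *s v - \<phi> z) < d" by (intro near) simp
        have "norm (e i \<zeta>) \<le> norm (G (x + \<zeta> *s v) - G (\<phi> z) - D (x + \<zeta> *s v - \<phi> z))"
          unfolding e_def by (rule Finite_Cartesian_Product.norm_nth_le)
        also have "\<dots> \<le> m / (4 * C) * norm (x + \<zeta> *s v - \<phi> z)"
          using \<zeta> by (intro d1) (simp add: d_def)
        also have "\<dots> \<le> m / (4 * C) * d" using \<zeta> m C by (intro mult_left_mono) auto
        finally show "norm (e i \<zeta>) \<le> m / (4 * C) * d" .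
      qed (use R in auto)
      moreover have "deriv (e i) 0 = - D v $ i"
        using DERIV_imp_deriv[OF ed[of 0 i]] R 0 by simp
      ultimately have "norm (D v $ i) \<le> m / (4 * C) * d / R" by simp
      also have "\<dots> = m * norm v / (2 * C)" using d v C by (simp add: R_def field_simps)
      finally show ?thesis .
    qed
    then have "(\<Sum>i\<in>UNIV. norm (D v $ i)) \<le> C * (m * norm v / (2 * C))"
      unfolding C_def by (intro sum_bounded_above)
    moreover have "norm (D v) \<le> (\<Sum>i\<in>UNIV. norm (D v $ i))"
      unfolding norm_vec_def by (rule L2_set_le_sum) auto
    ultimately have "m * norm v \<le> m * norm v / 2" using m(2)[of v] C by (simp add: field_simps)
    then show False using m(1) v by simp
  qed
  define W where "W = U \<inter> \<phi> -` ball (\<phi> z) (d / 2)"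
  show ?thesis
  proof
    show "open W" unfolding W_def
      by (rule continuous_open_preimage[OF chart_facts(4,1)[OF UA(1)] open_ball])
    show "z \<in> W" using UA d by (simp add: W_def)
    fix p V \<psi> v assume p: "p \<in> W" "(V, \<psi>) \<in> charts_at A p" and v: "v \<noteq> (0 :: complex^'n)"
    have V: "(V, \<psi>) \<in> A" "p \<in> V" "p \<in> U" using p by (auto simp: charts_at_def W_def)
    \<comment> \<open>Moving back recovers \<open>v\<close>, so its image in the fixed chart is
      nonzero.\<close>
    have "chart_deriv U \<phi> \<psi> p (chart_deriv V \<psi> \<phi> p v) = v"
      using chart_deriv_chain[OF V(1) UA(1) V(2,3) transition_has_derivative[OF UA(1) V(1,3,2)]]
        chart_deriv_self[OF V(1,2)] by metis
    then have "chart_deriv V \<psi> \<phi> p v \<noteq> 0"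
      using v linear_0[OF has_derivative_linear[OF transition_has_derivative[OF UA(1) V(1,3,2)]]] by metis
    then have "chart_deriv U \<phi> F p (chart_deriv V \<psi> \<phi> p v) \<noteq> 0"
      unfolding chart_deriv_def[of U \<phi> F] G_def[symmetric] using p(1) by (intro key) (auto simp: W_def)
    then show "chart_deriv V \<psi> F p v \<noteq> 0"
      using chart_deriv_chain[OF V(1) UA(1) V(2,3) holomorphic_map_has_derivative[OF F UA(1) V(3)]] by metis
  qed
qed

end

section \<open>Plurisubharmonicity of the potential\<close>

lemma usc_on_continuous:
  assumes "continuous_on S f"
  shows "usc_on S (\<lambda>x. ereal (f x))"
proof -
  have "openin (top_of_set S) {x \<in> S. ereal (f x) < c}" for c
  proof (cases c)
    case (real r)
    have "{x \<in> S. ereal (f x) < c} = S \<inter> f -` {..<r}" using real by auto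
    then show ?thesis using continuous_openin_preimage_gen[OF assms open_lessThan] by simp
  qed auto
  then show ?thesis by (simp add: usc_on_def)
qed

lemma usc_on_add_continuous:
  assumes f: "usc_on S f" and g: "continuous_on S g"
  shows "usc_on S (\<lambda>x. f x + ereal (g x))"
proof -
  have fin: "f x < \<infinity>" if "x \<in> S" for x using f that by (simp add: usc_on_def)
  have "openin (top_of_set S) {x \<in> S. f x + ereal (g x) < c}" for c
  proof (cases c)
    case (real r)
    show ?thesis
    proof (subst openin_subopen, rule ballI)
      fix x assume "x \<in> {x \<in> S. f x + ereal (g x) < c}"
      then have x: "x \<in> S" "f x + ereal (g x) < ereal r" by (auto simp: real)
      then have "f x < ereal (r - g x)" by (cases "f x") auto
      then obtain d where d: "f x < ereal d" "ereal d < ereal (r - g x)"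
        using ereal_dense2 by blast
      let ?T = "{y \<in> S. f y < ereal d} \<inter> (S \<inter> g -` {..<r - d})"
      have "openin (top_of_set S) ?T"
        using f by (intro openin_Int continuous_openin_preimage_gen[OF g open_lessThan]) (simp add: usc_on_def)
      moreover have "x \<in> ?T" using x d by auto
      moreover have "?T \<subseteq> {x \<in> S. f x + ereal (g x) < c}"
      proof
        fix y assume "y \<in> ?T"
        then show "y \<in> {x \<in> S. f x + ereal (g x) < c}"
          unfolding real by (cases "f y") auto
      qed
      ultimately show "\<exists>T. openin (top_of_set S) T \<and> x \<in> T \<and> T \<subseteq> {x \<in> S. f x + ereal (g x) < c}"
        by blast
    qed
  next
    case PInf
    then have "{x \<in> S. f x + ereal (g x) < c} = S" using fin by (auto simp: less_top[symmetric])
    then show ?thesis by simp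
  qed auto
  moreover have "\<forall>x\<in>S. f x + ereal (g x) < \<infinity>" using fin by (auto simp: less_top[symmetric])
  ultimately show ?thesis by (simp add: usc_on_def)
qed

lemma usc_on_attains_max:
  assumes "compact S" "S \<noteq> {}" and f: "usc_on S f"
  shows "\<exists>p\<in>S. \<forall>x\<in>S. f x \<le> f p"
proof (rule ccontr)
  assume "\<not> (\<exists>p\<in>S. \<forall>x\<in>S. f x \<le> f p)"
  then have ex: "\<exists>y\<in>S. f x < f y" if "x \<in> S" for x
    using that by (auto simp: not_le)
  define B where "B y = {x \<in> S. f x < f y}" for y
  have "\<forall>T\<in>B ` S. openin (top_of_set S) T" using f by (auto simp: B_def usc_on_def)
  moreover have "S \<subseteq> \<Union>(B ` S)" using ex by (auto simp: B_def)
  ultimately obtain D where D: "D \<subseteq> B ` S" "finite D" "S \<subseteq> \<Union>D"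
    using \<open>compact S\<close> unfolding compact_eq_openin_cover by meson
  then obtain Y where Y: "Y \<subseteq> S" "finite Y" "D = B ` Y" by (meson finite_subset_image)
  have "Y \<noteq> {}" using D(3) Y(3) \<open>S \<noteq> {}\<close> by auto
  then have "Max (f ` Y) \<in> f ` Y" using Y(2) by simp
  then obtain y where y: "y \<in> Y" "f y = Max (f ` Y)" by auto
  then obtain y' where "y' \<in> Y" "f y < f y'" using D(3) Y by (auto simp: B_def)
  moreover have "f y' \<le> f y" using y Y(2) \<open>y' \<in> Y\<close> by simp
  ultimately show False by simp
qed

lemma bil_holomorphic:
  assumes "\<And>i. (\<lambda>\<zeta>. Z \<zeta> $ i) holomorphic_on S"
  shows "(\<lambda>\<zeta>. bil l (Z \<zeta>)) holomorphic_on S"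
  unfolding bil_def by (intro holomorphic_intros assms)

text \<open>A holomorphic support from below serves every circle in its line about the contact
  point, so the mean value inequality follows from \<open>cmod_le_exp_circle_avg\<close>. The
  support may depend on both the line and the point, and it may have zeros.\<close>

lemma psh_onI:
  assumes cont: "continuous_on D g"
    and support: "\<And>a v z. a + z *s v \<in> D \<Longrightarrow> \<exists>s. s holomorphic_on {\<zeta>. a + \<zeta> *s v \<in> D}
        \<and> cmod (s z) = exp (g (a + z *s v)) \<and> (\<forall>\<zeta>. a + \<zeta> *s v \<in> D \<longrightarrow> cmod (s \<zeta>) \<le> exp (g (a + \<zeta> *s v)))"
  shows "psh_on D (\<lambda>x. ereal (g x))"
  unfolding psh_on_def
proof (intro conjI allI)
  show "usc_on D (\<lambda>x. ereal (g x))" by (rule usc_on_continuous[OF cont])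
  fix a v
  let ?V = "{\<zeta>. a + \<zeta> *s v \<in> D}" and ?g = "\<lambda>\<zeta>. g (a + \<zeta> *s v)"
  have cg: "continuous_on ?V ?g"
    by (rule continuous_on_compose2[OF cont continuous_on_complex_line]) auto
  show "subharmonic_on ?V (\<lambda>\<zeta>. ereal (?g \<zeta>))"
    unfolding subharmonic_on_def
  proof (intro conjI allI impI)
    show "usc_on ?V (\<lambda>\<zeta>. ereal (?g \<zeta>))" by (rule usc_on_continuous[OF cg])
    fix z r assume *: "0 < r \<and> cball z r \<subseteq> ?V"
    have "z \<in> cball z r" using * by simp
    then have "a + z *s v \<in> D" using * by blast
    then obtain s where s: "s holomorphic_on ?V" "cmod (s z) = exp (?g z)"
        "\<And>\<zeta>. \<zeta> \<in> ?V \<Longrightarrow> cmod (s \<zeta>) \<le> exp (?g \<zeta>)"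
      using support[of a z v] by blast
    have gs: "continuous_on (sphere z r) ?g"
      by (rule continuous_on_subset[OF cg]) (use * sphere_cball in blast)
    have "cmod (s z) \<le> exp (circle_avg ?g z r)"
    proof (rule cmod_le_exp_circle_avg)
      show "continuous_on (cball z r) s"
        using holomorphic_on_imp_continuous_on[OF s(1)] continuous_on_subset * by blast
      show "s holomorphic_on ball z r"
        using holomorphic_on_subset[OF s(1)] * ball_subset_cball by blast
      show "cmod (s w) \<le> exp (?g w)" if "dist z w = r" for w
      proof -
        have "w \<in> cball z r" using that by simp
        then show ?thesis using * by (intro s) blast
      qed
    qed (use * gs in auto)
    then have "?g z \<le> circle_avg ?g z r" by (simp add: s(2))
    then show "ereal (?g z) \<le> circle_mean (\<lambda>\<zeta>. ereal (?g \<zeta>)) z r"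
      using circle_mean_ereal[OF gs] * by simp
  qed
qed

text \<open>The set where \<open>lie2 (\<Phi> x) \<le> 1\<close> is compact for a proper
  \<open>\<Phi>\<close> and will belong to the exceptional set of the potential.\<close>

definition lie_potential :: "('a \<Rightarrow> complex^'m::finite) \<Rightarrow> 'a \<Rightarrow> real" where
  "lie_potential \<Phi> x = ln (max 1 (lie2 (\<Phi> x)))"

lemma continuous_on_lie_potential:
  "continuous_on S \<Phi> \<Longrightarrow> continuous_on S (lie_potential \<Phi>)"
  unfolding lie_potential_def by (intro continuous_intros) auto

lemma plurisubharmonic_lie_potential:
  fixes \<Phi> :: "'a::{t2_space,second_countable_topology} \<Rightarrow> complex^'m::finite"
  assumes A: "complex_atlas A" and hol: "holomorphic_map A \<Phi>" and card: "CARD('m) \<ge> 2"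
  shows "plurisubharmonic A \<Omega> (\<lambda>x. ereal (lie_potential \<Phi> x))"
  unfolding plurisubharmonic_def
proof (intro ballI, clarify)
  fix U \<phi> assume U: "(U, \<phi>) \<in> A"
  define F where "F = \<Phi> \<circ> inv_into U \<phi>"
  have F: "holomorphic_vec_on F (\<phi> ` U)"
    unfolding F_def by (rule holomorphic_map_in_chart[OF hol U])
  have "psh_on (\<phi> ` (U \<inter> \<Omega>)) (\<lambda>x. ereal (lie_potential F x))"
  proof (rule psh_onI)
    show "continuous_on (\<phi> ` (U \<inter> \<Omega>)) (lie_potential F)"
      by (intro continuous_on_lie_potential continuous_on_subset[OF holomorphic_vec_on_continuous[OF F]]) auto
    fix a v z assume "a + z *s v \<in> \<phi> ` (U \<inter> \<Omega>)"
    let ?V = "{\<zeta>. a + \<zeta> *s v \<in> \<phi> ` (U \<inter> \<Omega>)}"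
    have e: "exp (lie_potential F x) = max 1 (lie2 (F x))" for x
      by (simp add: lie_potential_def)
    show "\<exists>s. s holomorphic_on ?V \<and> cmod (s z) = exp (lie_potential F (a + z *s v)) \<and>
       (\<forall>\<zeta>. a + \<zeta> *s v \<in> \<phi> ` (U \<inter> \<Omega>) \<longrightarrow> cmod (s \<zeta>) \<le> exp (lie_potential F (a + \<zeta> *s v)))"
    \<comment> \<open>Where the cut-off is active the constant 1 is a support. Elsewhere the adapted
      form is one after squaring, because the potential is the logarithm of the squared Lie
      norm.\<close>
    proof (cases "lie2 (F (a + z *s v)) \<le> 1")
      case True
      then show ?thesis unfolding e by (intro exI[of _ "\<lambda>_. 1"]) auto
    next
      case False
      obtain l where l: "isotropic_frame l" "frame_perp l (F (a + z *s v)) = 0"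
          "cmod (bil (cnj_vec l) (F (a + z *s v))) \<le> cmod (bil l (F (a + z *s v)))"
        using exists_adapted_frame[OF card] by metis
      have "(\<lambda>\<zeta>. (bil l (F (a + \<zeta> *s v)))\<^sup>2) holomorphic_on ?V"
        by (intro holomorphic_intros bil_holomorphic holomorphic_on_subset[OF complex_line_holomorphic[OF F]]) auto
      moreover have "cmod ((bil l (F x))\<^sup>2) \<le> max 1 (lie2 (F x))" for x
        using bil_frame_le_lie2[OF l(1), of "F x"] by (simp add: norm_power le_max_iff_disj)
      ultimately show ?thesis using lie2_adapted_frame[OF l] False unfolding e
        by (intro exI[of _ "\<lambda>\<zeta>. (bil l (F (a + \<zeta> *s v)))\<^sup>2"]) (auto simp: norm_power)
    qed
  qed
  then show "psh_on (\<phi> ` (U \<inter> \<Omega>)) ((\<lambda>x. ereal (lie_potential \<Phi> x)) \<circ> inv_into U \<phi>)"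
    by (simp add: F_def lie_potential_def o_def)
qed

section \<open>Contact along holomorphic discs\<close>

lemma subharmonic_no_strict_contact:
  assumes sub: "subharmonic_on V v" and v0: "v 0 = ereal c"
    and N: "open N" "0 \<in> N" "N \<subseteq> V" and g: "g holomorphic_on N" "g 0 = 0" and k: "k > 0"
    and le: "\<And>\<zeta>. \<zeta> \<in> N \<Longrightarrow> v \<zeta> \<le> ereal (c + Re (g \<zeta>) - k * (cmod \<zeta>)\<^sup>2)"
  shows False
proof -
  obtain r where r: "r > 0" "cball 0 r \<subseteq> N" using N open_contains_cball by blast
  have gc: "continuous_on (cball 0 r) g"
    using holomorphic_on_imp_continuous_on[OF g(1)] continuous_on_subset r(2) by blast
  have gs: "continuous_on (sphere 0 r) (\<lambda>w. Re (g w))"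
    by (intro continuous_intros continuous_on_subset[OF gc]) auto
  \<comment> \<open>On the circle the majorant has mean \<open>c - k * r\<^sup>2\<close>, as
    \<open>Re (g w)\<close> averages to \<open>Re (g 0) = 0\<close>. This lies below the central
    value \<open>c\<close>.\<close>
  have "ereal c \<le> circle_mean v 0 r"
    using sub r N(3) v0 unfolding subharmonic_on_def by (metis order_trans)
  also have "\<dots> \<le> circle_mean (\<lambda>w. ereal (Re (g w) + (c - k * r\<^sup>2))) 0 r"
  proof (rule circle_mean_mono[OF r(1)])
    fix w :: complex assume w: "dist 0 w = r"
    then show "v w \<le> ereal (Re (g w) + (c - k * r\<^sup>2))"
      using le[of w] r(2) by (auto simp: algebra_simps)
  qed
  also have "\<dots> = ereal (circle_avg (\<lambda>w. Re (g w) + (c - k * r\<^sup>2)) 0 r)"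
    by (rule circle_mean_ereal) (use gs r in \<open>auto intro!: continuous_intros\<close>)
  also have "\<dots> = ereal (c - k * r\<^sup>2)"
    using circle_avg_add_const[OF gs r(1)] circle_avg_Re_holomorphic[OF gc holomorphic_on_subset[OF g(1)] r(1)]
      r(2) ball_subset_cball g(2) by fastforce
  finally have "k * r\<^sup>2 \<le> 0" by simp
  moreover have "k * r\<^sup>2 > 0" using k r(1) by simp
  ultimately show False by simp
qed

lemma bounded_linear_frame_perp: "bounded_linear (frame_perp l)"
  for l :: "complex^'m::finite"
proof -
  have "c *\<^sub>R x = of_real c *s x" for c and x :: "complex^'m"
    by (simp only: vec_eq_iff vector_scaleR_component vector_smult_component) (simp add: scaleR_conv_of_real)
  then have "linear (frame_perp l)"
    by (intro linearI) (auto simp: frame_perp_simps)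
  then show ?thesis by (simp add: linear_conv_bounded_linear)
qed

lemma eventually_nhds_gt_isCont:
  fixes f :: "'a::t2_space \<Rightarrow> real"
  shows "isCont f x \<Longrightarrow> c < f x \<Longrightarrow> \<forall>\<^sub>F y in nhds x. c < f y"
  unfolding isCont_def tendsto_at_iff_tendsto_nhds by (rule order_tendstoD(1))

text \<open>If a disc is tangent to the plane spanned by a point and its conjugate, then along it the
  logarithm of the Lie norm is harmonic up to \<open>o(\<bar>\<zeta>\<bar>\<^sup>2)\<close>, because its distance to the plane is
  \<open>o(\<bar>\<zeta>\<bar>)\<close> and enters quadratically.\<close>

lemma ln_lie2_tangent_disc:
  fixes Z :: "complex \<Rightarrow> complex^'m::finite"
  assumes card: "CARD('m) \<ge> 2" and N: "open N" "0 \<in> N"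
    and Z: "\<And>i. (\<lambda>\<zeta>. Z \<zeta> $ i) holomorphic_on N"
    and dZ: "(Z has_derivative (\<lambda>\<zeta>. \<zeta> *s a)) (at 0)"
    and a: "a \<in> vec.span {Z 0, cnj_vec (Z 0)}" and CR: "Z 0 \<notin> CR" and \<delta>: "\<delta> > 0"
  obtains N' h where "open N'" "0 \<in> N'" "N' \<subseteq> N" "h holomorphic_on N'" "h 0 = 0"
    "\<And>\<zeta>. \<zeta> \<in> N' \<Longrightarrow> ln (lie2 (Z \<zeta>)) \<le> ln (lie2 (Z 0)) + Re (h \<zeta>) + \<delta> * (cmod \<zeta>)\<^sup>2"
proof -
  obtain l where l: "isotropic_frame l" "frame_perp l (Z 0) = 0"
      and le0: "cmod (bil (cnj_vec l) (Z 0)) \<le> cmod (bil l (Z 0))"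
      and lt0: "cmod (bil (cnj_vec l) (Z 0)) < cmod (bil l (Z 0))"
    using exists_adapted_frame[OF card] CR by metis
  define s where "s \<zeta> = bil l (Z \<zeta>)" for \<zeta>
  define t where "t \<zeta> = bil (cnj_vec l) (Z \<zeta>)" for \<zeta>
  define q where "q \<zeta> = frame_perp l (Z \<zeta>)" for \<zeta>
  \<comment> \<open>The relative error in \<open>lie2_le_frame\<close>: \<open>lie2\<close> exceeds
    \<open>(cmod (s \<zeta>))\<^sup>2\<close> at most by the factor 1 + |q|^2 M. The strict
    inequality of the two forms at the centre makes \<open>M\<close> continuous there.\<close>
  define M where "M \<zeta> = (1 + (2 * ((cmod (s \<zeta>))\<^sup>2 + (cmod (t \<zeta>))\<^sup>2) + (norm (q \<zeta>))\<^sup>2)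
      / ((cmod (s \<zeta>))\<^sup>2 - (cmod (t \<zeta>))\<^sup>2)) / (cmod (s \<zeta>))\<^sup>2" for \<zeta>
  have s0: "s 0 \<noteq> 0" using lt0 by (auto simp: s_def)
  have lt: "cmod (t 0) < cmod (s 0)" using lt0 by (simp add: s_def t_def)
  have Zc: "isCont Z 0" by (rule has_derivative_continuous[OF dZ])
  have sc: "isCont s 0" and tc: "isCont t 0"
    unfolding s_def t_def bil_def by (intro continuous_intros bounded_linear.continuous[OF bounded_linear_vec_nth] Zc)+
  have qc: "isCont q 0"
    unfolding q_def by (rule bounded_linear.continuous[OF bounded_linear_frame_perp Zc])
  \<comment> \<open>The kernel of \<open>frame_perp l\<close> contains \<open>Z 0\<close> and, by
    compatibility with conjugation, \<open>cnj_vec (Z 0)\<close>. Hence it contains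
    \<open>a\<close>, and \<open>q\<close> vanishes to first order at 0.\<close>
  have "frame_perp l (cnj_vec (Z 0)) = 0"
    unfolding frame_perp_cnj_vec l(2) by (simp add: vec_eq_iff cnj_vec_def)
  moreover have "vec.subspace {x. frame_perp l x = 0}"
    by (rule vec.subspaceI) (auto simp: frame_perp_simps linear_0[OF bounded_linear.linear[OF bounded_linear_frame_perp]])
  ultimately have "vec.span {Z 0, cnj_vec (Z 0)} \<subseteq> {x. frame_perp l x = 0}"
    using l(2) by (intro vec.span_minimal) auto
  then have "frame_perp l a = 0" using a by blast
  then have dq: "(q has_derivative (\<lambda>\<zeta>. 0)) (at 0)"
    using bounded_linear.has_derivative[OF bounded_linear_frame_perp dZ, of l]
    by (simp add: q_def[abs_def] frame_perp_simps)
  define B where "B = \<bar>M 0\<bar> + 1"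
  have B: "B > 0" by (simp add: B_def)
  \<comment> \<open>Chosen so that \<open>norm (q \<zeta>) \<le> e * cmod \<zeta>\<close> and
    \<open>M \<zeta> < B\<close> together bound the relative error by
    \<open>\<delta> * (cmod \<zeta>)\<^sup>2\<close>.\<close>
  define e where "e = sqrt (\<delta> / B)"
  have e: "e > 0" "e\<^sup>2 * B = \<delta>" using B \<delta> by (auto simp: e_def)
  obtain d where d: "d > 0" "\<And>\<zeta>. cmod \<zeta> < d \<Longrightarrow> norm (q \<zeta>) \<le> e * cmod \<zeta>"
    using dq e(1) l(2) unfolding has_derivative_at_alt by (auto simp: q_def)
  have "isCont M 0"
    unfolding M_def using lt s0 by (intro continuous_intros sc tc qc) (auto simp: power2_eq_iff_nonneg)
  then have "isCont (\<lambda>\<zeta>. - M \<zeta>) 0" by (intro continuous_intros)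
  then have "\<forall>\<^sub>F \<zeta> in nhds 0. - B < - M \<zeta>"
    by (rule eventually_nhds_gt_isCont) (simp add: B_def)
  moreover have "\<forall>\<^sub>F \<zeta> in nhds 0. 0 < cmod (s \<zeta>) - cmod (t \<zeta>)"
    by (intro eventually_nhds_gt_isCont continuous_intros sc tc) (use lt in simp)
  \<comment> \<open>A positive real part keeps the quotient off the branch cut of
    \<open>Ln\<close>.\<close>
  moreover have "isCont (\<lambda>\<zeta>. Re (s \<zeta> / s 0)) 0"
    by (intro isCont_Re isCont_divide sc s0 continuous_const)
  then have "\<forall>\<^sub>F \<zeta> in nhds 0. 0 < Re (s \<zeta> / s 0)"
    by (rule eventually_nhds_gt_isCont) (use s0 in simp)
  moreover have "\<forall>\<^sub>F \<zeta> in nhds 0. norm (q \<zeta>) \<le> e * cmod \<zeta>"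
    using d unfolding eventually_nhds_metric by (intro exI[of _ d]) auto
  moreover have "\<forall>\<^sub>F \<zeta> in nhds 0. \<zeta> \<in> N" using N eventually_nhds by blast
  ultimately have "\<forall>\<^sub>F \<zeta> in nhds 0. \<zeta> \<in> N \<and> M \<zeta> < B \<and> cmod (t \<zeta>) < cmod (s \<zeta>)
      \<and> Re (s \<zeta> / s 0) > 0 \<and> norm (q \<zeta>) \<le> e * cmod \<zeta>"
    by eventually_elim auto
  then obtain N' where N': "open N'" "0 \<in> N'"
      and *: "\<And>\<zeta>. \<zeta> \<in> N' \<Longrightarrow> \<zeta> \<in> N \<and> M \<zeta> < B \<and> cmod (t \<zeta>) < cmod (s \<zeta>)
      \<and> Re (s \<zeta> / s 0) > 0 \<and> norm (q \<zeta>) \<le> e * cmod \<zeta>"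
    unfolding eventually_nhds by blast
  \<comment> \<open>The factor 2 reflects that \<open>lie2\<close> is a square:
    \<open>Re (h \<zeta>)\<close> is the increment of the logarithm of
    \<open>(cmod (s \<zeta>))\<^sup>2\<close>.\<close>
  define h where "h \<zeta> = 2 * Ln (s \<zeta> / s 0)" for \<zeta>
  show ?thesis
  proof (rule that[OF N'])
    show "N' \<subseteq> N" using * by blast
    have "s holomorphic_on N'"
      unfolding s_def by (intro bil_holomorphic holomorphic_on_subset[OF Z] \<open>N' \<subseteq> N\<close>)
    moreover have "s \<zeta> / s 0 \<notin> \<real>\<^sub>\<le>\<^sub>0" if "\<zeta> \<in> N'" for \<zeta>
      using *[OF that] by (auto simp: complex_nonpos_Reals_iff)
    ultimately show "h holomorphic_on N'"
      unfolding h_def using s0 by (intro holomorphic_intros) auto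
    show "h 0 = 0" using s0 by (simp add: h_def)
    fix \<zeta> assume "\<zeta> \<in> N'"
    note \<zeta> = *[OF this]
    define A Q where "A = (cmod (s \<zeta>))\<^sup>2" and "Q = (norm (q \<zeta>))\<^sup>2"
    have sz: "s \<zeta> \<noteq> 0" using \<zeta> by auto
    have A: "A > 0" using sz by (simp add: A_def)
    have ba: "(cmod (t \<zeta>))\<^sup>2 < A" using \<zeta> by (simp add: A_def power_strict_mono)
    have M0: "M \<zeta> \<ge> 0" unfolding M_def using \<zeta>
      by (intro divide_nonneg_nonneg add_nonneg_nonneg) auto
    have "A \<le> lie2 (Z \<zeta>)" unfolding A_def s_def by (rule bil_frame_le_lie2[OF l(1)])
    then have pos: "0 < lie2 (Z \<zeta>)" using A by linarith
    have "lie2 (Z \<zeta>) \<le> A + Q * (M \<zeta> * A)"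
      using lie2_le_frame[OF l(1), of "Z \<zeta>"] ba A unfolding A_def Q_def M_def s_def t_def q_def by simp
    also have "\<dots> = A * (1 + Q * M \<zeta>)" by (simp add: algebra_simps)
    finally have "ln (lie2 (Z \<zeta>)) \<le> ln (A * (1 + Q * M \<zeta>))"
      using pos by (intro ln_le_cancel_iff[THEN iffD2]) linarith+
    also have "\<dots> = ln A + ln (1 + Q * M \<zeta>)"
      using A M0 by (intro ln_mult_pos) (auto simp: Q_def intro!: add_pos_nonneg)
    also have "\<dots> \<le> ln A + Q * M \<zeta>"
      using M0 by (intro add_left_mono ln_add_one_self_le_self) (auto simp: Q_def)
    also have "Q * M \<zeta> \<le> (e * cmod \<zeta>)\<^sup>2 * B"
      unfolding Q_def using \<zeta> M0 by (intro mult_mono power_mono) auto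
    also have "\<dots> = \<delta> * (cmod \<zeta>)\<^sup>2" using e(2) by (simp add: power_mult_distrib mult_ac)
    also have "ln A = ln (lie2 (Z 0)) + Re (h \<zeta>)"
      unfolding lie2_adapted_frame[OF l le0] s_def[symmetric] A_def h_def
      using sz s0 by (simp add: ln_realpow norm_divide ln_div algebra_simps)
    finally show "ln (lie2 (Z \<zeta>)) \<le> ln (lie2 (Z 0)) + Re (h \<zeta>) + \<delta> * (cmod \<zeta>)\<^sup>2" by simp
  qed
qed

section \<open>Maximality of the potential\<close>

text \<open>Splits off the first-order term as the real part of something holomorphic in
  \<open>y\<close>; the remaining square is the source of strict plurisubharmonicity.\<close>

lemma norm2_vec_expand:
  "(norm y)\<^sup>2 = (norm x)\<^sup>2 + Re (2 * bil (cnj_vec x) (y - x)) + (norm (y - x))\<^sup>2"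
  for x y :: "complex^'m::finite"
proof -
  define d where "d = y - x"
  have y: "y = x + d" by (simp add: d_def)
  have "of_real ((norm y)\<^sup>2) = bil (x + d) (cnj_vec (x + d))" by (simp only: bil_cnj_vec y)
  also have "\<dots> = of_real ((norm x)\<^sup>2) + bil x (cnj_vec d) + bil d (cnj_vec x) + of_real ((norm d)\<^sup>2)"
    unfolding bil_cnj_vec[symmetric] by (simp add: bil_simps)
  also have "bil x (cnj_vec d) = cnj (bil (cnj_vec x) d)" by (simp add: cnj_bil)
  also have "bil d (cnj_vec x) = bil (cnj_vec x) d" by (rule bil_commute)
  finally have "Re (of_real ((norm y)\<^sup>2)) = Re (of_real ((norm x)\<^sup>2) + cnj (bil (cnj_vec x) d)
      + bil (cnj_vec x) d + of_real ((norm d)\<^sup>2))" by (rule arg_cong)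
  then show ?thesis by (simp add: d_def)
qed

lemma chart_line_has_derivative:
  assumes A: "complex_atlas A" and F: "holomorphic_map A F" and U: "(U, \<phi>) \<in> A" "p \<in> U"
  shows "((\<lambda>\<zeta>. F (inv_into U \<phi> (\<phi> p + \<zeta> *s v))) has_derivative (\<lambda>\<zeta>. \<zeta> *s chart_deriv U \<phi> F p v)) (at 0)"
proof -
  let ?G = "F \<circ> inv_into U \<phi>"
  have G: "holomorphic_vec_on ?G (\<phi> ` U)" by (rule holomorphic_map_in_chart[OF F U(1)])
  have in_U: "\<phi> p + 0 *s v \<in> \<phi> ` U" using U(2) by simp
  have "((\<lambda>\<zeta>. ?G (\<phi> p + \<zeta> *s v)) has_derivative
      (\<lambda>\<zeta>. frechet_derivative ?G (at (\<phi> p + 0 *s v)) (\<zeta> *s v))) (at 0)"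
    by (rule has_derivative_compose[OF has_derivative_complex_line holomorphic_vec_onD(1)[OF G in_U]])
  then show ?thesis
    unfolding frechet_derivative_scale[OF G in_U] by (simp add: chart_deriv_def)
qed

lemma chart_line_holomorphic:
  assumes "holomorphic_map A F" "(U, \<phi>) \<in> A"
  shows "(\<lambda>\<zeta>. F (inv_into U \<phi> (a + \<zeta> *s v)) $ i) holomorphic_on {\<zeta>. a + \<zeta> *s v \<in> \<phi> ` U}"
  using complex_line_holomorphic[OF holomorphic_map_in_chart[OF assms], of a v i] by simp

text \<open>A quadratic lower support instead of a positive Laplacian: it needs no second
  derivatives and is the form in which the gain enters the comparison.\<close>

definition strictly_subharmonic_at_0 :: "(complex \<Rightarrow> real) \<Rightarrow> complex set \<Rightarrow> bool" where
  "strictly_subharmonic_at_0 f V \<longleftrightarrow> (\<exists>N g k. open N \<and> 0 \<in> N \<and> N \<subseteq> V \<and> g holomorphic_on N \<and> g 0 = 0 \<and> 0 < k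
     \<and> (\<forall>\<zeta>\<in>N. f 0 + Re (g \<zeta>) + k * (cmod \<zeta>)\<^sup>2 \<le> f \<zeta>))"

text \<open>Each point has a global holomorphic map to coordinate space that is immersive near it.
  Finitely many of these neighbourhoods cover \<open>C\<close>, and the squared norms are added: at
  any point one map gives the quadratic growth and the others contribute nonnegative
  squares.\<close>

lemma stein_strictly_psh_function:
  fixes A :: "('a::{t2_space,second_countable_topology}, 'n::finite) chart set"
  assumes stein: "stein_manifold A" and C: "compact C"
  shows "\<exists>\<rho> :: 'a \<Rightarrow> real. continuous_on UNIV \<rho> \<and> (\<forall>x. 0 \<le> \<rho> x) \<and>
    (\<forall>p\<in>C. \<forall>U \<phi> v. (U, \<phi>) \<in> charts_at A p \<longrightarrow> v \<noteq> 0 \<longrightarrow>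
       strictly_subharmonic_at_0 (\<lambda>\<zeta>. \<rho> (inv_into U \<phi> (\<phi> p + \<zeta> *s v))) {\<zeta>. \<phi> p + \<zeta> *s v \<in> \<phi> ` U})"
proof -
  have A: "complex_atlas A" using stein by (simp add: stein_manifold_def)
  have "\<forall>z. \<exists>FW. holomorphic_map A (fst FW :: 'a \<Rightarrow> complex^'n) \<and> open (snd FW) \<and> z \<in> snd FW \<and>
     (\<forall>p U \<phi> v. p \<in> snd FW \<longrightarrow> (U, \<phi>) \<in> charts_at A p \<longrightarrow> v \<noteq> 0 \<longrightarrow> chart_deriv U \<phi> (fst FW) p v \<noteq> 0)"
  proof
    fix z
    obtain F :: "'a \<Rightarrow> complex^'n" where F: "holomorphic_map A F"
        "inj_on (differential A F z) (tangent_space A z)"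
      using stein unfolding stein_manifold_def by blast
    obtain W where "open W" "z \<in> W"
      "\<And>p U \<phi> v. p \<in> W \<Longrightarrow> (U, \<phi>) \<in> charts_at A p \<Longrightarrow> v \<noteq> 0 \<Longrightarrow> chart_deriv U \<phi> F p v \<noteq> 0"
      using holomorphic_immersion_open[OF A F] by blast
    then show "\<exists>FW. holomorphic_map A (fst FW :: 'a \<Rightarrow> complex^'n) \<and> open (snd FW) \<and> z \<in> snd FW \<and>
     (\<forall>p U \<phi> v. p \<in> snd FW \<longrightarrow> (U, \<phi>) \<in> charts_at A p \<longrightarrow> v \<noteq> 0 \<longrightarrow> chart_deriv U \<phi> (fst FW) p v \<noteq> 0)"
      using F(1) by (intro exI[of _ "(F, W)"]) auto
  qed
  from choice[OF this] obtain FW :: "'a \<Rightarrow> ('a \<Rightarrow> complex^'n) \<times> 'a set" where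
    FW: "\<forall>z. holomorphic_map A (fst (FW z)) \<and> open (snd (FW z)) \<and> z \<in> snd (FW z) \<and>
     (\<forall>p U \<phi> v. p \<in> snd (FW z) \<longrightarrow> (U, \<phi>) \<in> charts_at A p \<longrightarrow> v \<noteq> 0 \<longrightarrow> chart_deriv U \<phi> (fst (FW z)) p v \<noteq> 0)"
    by (elim exE)
  define F W where "F z = fst (FW z)" and "W z = snd (FW z)" for z
  have F: "holomorphic_map A (F z)" and W: "open (W z)" "z \<in> W z" for z
    using FW by (auto simp: F_def W_def)
  have imm: "chart_deriv U \<phi> (F z) p v \<noteq> 0"
    if "p \<in> W z" "(U, \<phi>) \<in> charts_at A p" "v \<noteq> 0" for z p U \<phi> v
    using FW that unfolding F_def W_def by blast
  have "C \<subseteq> (\<Union>z\<in>C. W z)" using W(2) by blast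
  then obtain Z where Z: "Z \<subseteq> C" "finite Z" "C \<subseteq> (\<Union>z\<in>Z. W z)"
    using compactE_image[OF C, of C W] W(1) by metis
  define \<rho> where "\<rho> x = (\<Sum>z\<in>Z. (norm (F z x))\<^sup>2)" for x
  show ?thesis
  proof (intro exI[of _ \<rho>] conjI allI ballI impI)
    show "continuous_on UNIV \<rho>"
      unfolding \<rho>_def by (intro continuous_intros holomorphic_map_continuous[OF A F])
    show "0 \<le> \<rho> x" for x by (simp add: \<rho>_def sum_nonneg)
    fix p U \<phi> and v :: "complex^'n"
    assume p: "p \<in> C" and chart: "(U, \<phi>) \<in> charts_at A p" and v: "v \<noteq> 0"
    have U: "(U, \<phi>) \<in> A" "p \<in> U" using chart by (auto simp: charts_at_def)
    obtain z0 where z0: "z0 \<in> Z" "p \<in> W z0" using Z(3) p by blast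
    let ?V = "{\<zeta>. \<phi> p + \<zeta> *s v \<in> \<phi> ` U}"
    define Y where "Y z \<zeta> = F z (inv_into U \<phi> (\<phi> p + \<zeta> *s v))" for z \<zeta>
    define a where "a = chart_deriv U \<phi> (F z0) p v"
    have a: "norm a > 0" using imm[OF z0(2) chart v] by (simp add: a_def)
    have "(Y z0 has_derivative (\<lambda>\<zeta>. \<zeta> *s a)) (at 0)"
      unfolding Y_def[abs_def] a_def by (rule chart_line_has_derivative[OF A F U])
    moreover have "norm a / 2 > 0" using a by simp
    ultimately obtain d where d: "d > 0"
      "\<And>\<zeta>. cmod \<zeta> < d \<Longrightarrow> norm (Y z0 \<zeta> - Y z0 0 - \<zeta> *s a) \<le> norm a / 2 * cmod \<zeta>"
      unfolding has_derivative_at_alt by (metis diff_zero)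
    define N where "N = ?V \<inter> ball 0 d"
    \<comment> \<open>The holomorphic first-order terms of \<open>norm2_vec_expand\<close>, summed
      over all the maps.\<close>
    define g where "g \<zeta> = (\<Sum>z\<in>Z. 2 * bil (cnj_vec (Y z 0)) (Y z \<zeta> - Y z 0))" for \<zeta>
    \<comment> \<open>On the ball the remainder costs half of the linear growth, so
      \<open>Y z0\<close> moves by at least \<open>norm a / 2 * cmod \<zeta>\<close>; squaring gives
      the quarter.\<close>
    define k where "k = (norm a)\<^sup>2 / 4"
    have "open ?V" by (rule open_complex_line[OF chart_facts(2)[OF A U(1)]])
    then have "open N" by (simp add: N_def open_Int)
    moreover have "0 \<in> N" using U(2) d(1) by (simp add: N_def)
    moreover have "N \<subseteq> ?V" by (simp add: N_def)
    moreover have "g holomorphic_on N"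
      unfolding g_def
    proof (intro holomorphic_intros bil_holomorphic)
      fix z i
      have "(\<lambda>\<zeta>. Y z \<zeta> $ i - Y z 0 $ i) holomorphic_on N"
        unfolding Y_def N_def
        by (intro holomorphic_intros holomorphic_on_subset[OF chart_line_holomorphic[OF F U(1)]]) auto
      then show "(\<lambda>\<zeta>. (Y z \<zeta> - Y z 0) $ i) holomorphic_on N" by simp
    qed
    moreover have "g 0 = 0" by (simp add: g_def bil_def)
    moreover have "k > 0" using a by (simp add: k_def)
    moreover have "\<rho> (inv_into U \<phi> (\<phi> p + 0 *s v)) + Re (g \<zeta>) + k * (cmod \<zeta>)\<^sup>2
         \<le> \<rho> (inv_into U \<phi> (\<phi> p + \<zeta> *s v))" if "\<zeta> \<in> N" for \<zeta>
    proof -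
      have "norm (\<zeta> *s a) - norm (Y z0 \<zeta> - Y z0 0) \<le> norm a / 2 * cmod \<zeta>"
        using that d(2)[of \<zeta>] norm_triangle_ineq2[of "\<zeta> *s a" "Y z0 \<zeta> - Y z0 0"]
        by (simp add: N_def norm_minus_commute)
      then have "norm a / 2 * cmod \<zeta> \<le> norm (Y z0 \<zeta> - Y z0 0)"
        by (simp add: norm_vec_scale mult.commute)
      then have "(norm a / 2 * cmod \<zeta>)\<^sup>2 \<le> (norm (Y z0 \<zeta> - Y z0 0))\<^sup>2"
        by (intro power_mono) auto
      then have "k * (cmod \<zeta>)\<^sup>2 \<le> (norm (Y z0 \<zeta> - Y z0 0))\<^sup>2"
        by (simp add: k_def power_mult_distrib power_divide)
      also have "\<dots> \<le> (\<Sum>z\<in>Z. (norm (Y z \<zeta> - Y z 0))\<^sup>2)"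
        by (rule member_le_sum[OF z0(1)]) (use Z(2) in auto)
      finally have le: "k * (cmod \<zeta>)\<^sup>2 \<le> (\<Sum>z\<in>Z. (norm (Y z \<zeta> - Y z 0))\<^sup>2)" .
      have "(\<Sum>z\<in>Z. (norm (Y z \<zeta>))\<^sup>2) = (\<Sum>z\<in>Z. (norm (Y z 0))\<^sup>2) + Re (g \<zeta>)
          + (\<Sum>z\<in>Z. (norm (Y z \<zeta> - Y z 0))\<^sup>2)"
        unfolding g_def Re_sum sum.distrib[symmetric] by (intro sum.cong refl norm2_vec_expand)
      then show ?thesis using le by (simp add: \<rho>_def Y_def)
    qed
    ultimately show "strictly_subharmonic_at_0 (\<lambda>\<zeta>. \<rho> (inv_into U \<phi> (\<phi> p + \<zeta> *s v))) ?V"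
      unfolding strictly_subharmonic_at_0_def by blast
  qed
qed

text \<open>At a maximum point of \<open>v - u + \<epsilon> \<rho>\<close>, with \<open>\<rho>\<close> strictly plurisubharmonic, the restriction to the
  complex line along which \<open>u\<close> is harmonic to second order violates the mean value inequality for \<open>v\<close>.\<close>

lemma maximal_lie_potential:
  fixes A :: "('a::{t2_space,second_countable_topology}, 'n::finite) chart set"
    and \<Phi> :: "'a \<Rightarrow> complex^'m::finite"
  assumes stein: "stein_manifold A" and hol: "holomorphic_map A \<Phi>" and card: "CARD('m) \<ge> 2"
    and \<Omega>: "\<Omega> = {x. \<Phi> x \<notin> CR \<and> 1 < lie2 (\<Phi> x)}"
    and dir: "\<And>x. \<Phi> x \<notin> CR \<Longrightarrow> \<exists>U \<phi> w. (U, \<phi>) \<in> charts_at A x \<and> w \<noteq> 0 \<and>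
        chart_deriv U \<phi> \<Phi> x w \<in> vec.span {\<Phi> x, cnj_vec (\<Phi> x)}"
  shows "maximal_psh A \<Omega> (\<lambda>x. ereal (lie_potential \<Phi> x))"
  unfolding maximal_psh_def
proof (intro conjI allI impI ballI; (elim conjE)?)
  have A: "complex_atlas A" using stein by (simp add: stein_manifold_def)
  show "plurisubharmonic A \<Omega> (\<lambda>x. ereal (lie_potential \<Phi> x))"
    by (rule plurisubharmonic_lie_potential[OF A hol card])
  fix G v x0
  assume G: "open G" "compact (closure G)" "closure G \<subseteq> \<Omega>"
    and usc: "usc_on (closure G) v" and psh: "plurisubharmonic A G v"
    and bdry: "\<forall>x\<in>frontier G. v x \<le> ereal (lie_potential \<Phi> x)" and x0: "x0 \<in> G"
  define u where "u = lie_potential \<Phi>"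
  have cont_u: "continuous_on UNIV u"
    unfolding u_def by (rule continuous_on_lie_potential[OF holomorphic_map_continuous[OF A hol]])
  show "v x0 \<le> ereal (lie_potential \<Phi> x0)"
  proof (rule ccontr)
    assume "\<not> v x0 \<le> ereal (lie_potential \<Phi> x0)"
    then have gt: "ereal (u x0) < v x0" by (simp add: u_def)
    have x0c: "x0 \<in> closure G" using x0 closure_subset by blast
    have fin: "v x < \<infinity>" if "x \<in> closure G" for x using usc that by (simp add: usc_on_def)
    obtain c0 where c0: "v x0 = ereal c0" using gt fin[OF x0c] by (cases "v x0") auto
    obtain \<rho> :: "'a \<Rightarrow> real" where \<rho>: "continuous_on UNIV \<rho>" "\<forall>x. 0 \<le> \<rho> x"
      "\<forall>p\<in>closure G. \<forall>U \<phi> v. (U, \<phi>) \<in> charts_at A p \<longrightarrow> v \<noteq> 0 \<longrightarrow>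
       strictly_subharmonic_at_0 (\<lambda>\<zeta>. \<rho> (inv_into U \<phi> (\<phi> p + \<zeta> *s v))) {\<zeta>. \<phi> p + \<zeta> *s v \<in> \<phi> ` U}"
      using stein_strictly_psh_function[OF stein G(2)] by (elim exE conjE)
    have "compact (\<rho> ` closure G)"
      by (rule compact_continuous_image[OF continuous_on_subset[OF \<rho>(1)] G(2)]) simp
    then obtain M where M: "M > 0" "\<And>x. x \<in> closure G \<Longrightarrow> \<rho> x \<le> M"
      using compact_imp_bounded bounded_pos by (metis abs_le_D1 imageI real_norm_def)
    \<comment> \<open>Half of the excess of \<open>v\<close> over \<open>u\<close> at
      \<open>x0\<close>, relative to the bound \<open>M\<close> of \<open>\<rho>\<close>. The
      perturbation then cannot create the excess by itself: \<open>v\<close> still exceeds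
      \<open>u\<close> at the maximum point \<open>p\<close>, which keeps \<open>p\<close> off the
      frontier.\<close>
    define \<epsilon> where "\<epsilon> = (c0 - u x0) / (2 * M)"
    have \<epsilon>: "\<epsilon> > 0" "\<epsilon> * M < c0 - u x0"
      using gt M(1) by (auto simp: \<epsilon>_def c0 field_simps)
    \<comment> \<open>The finite terms are collected into one real summand because \<open>v\<close>
      may take the value minus infinity.\<close>
    define f where "f x = v x + ereal (\<epsilon> * \<rho> x - u x)" for x
    have usc_f: "usc_on (closure G) f"
      unfolding f_def
      by (intro usc_on_add_continuous[OF usc] continuous_intros continuous_on_subset[OF \<rho>(1)]
          continuous_on_subset[OF cont_u]) auto
    have "closure G \<noteq> {}" using x0 by auto
    from usc_on_attains_max[OF G(2) this usc_f]
    obtain p where p: "p \<in> closure G" "\<And>x. x \<in> closure G \<Longrightarrow> f x \<le> f p" by blast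
    have "\<epsilon> * \<rho> x0 \<ge> 0" using \<epsilon>(1) \<rho>(2) by simp
    then have "ereal (c0 - u x0) \<le> f x0" by (simp add: f_def c0)
    also have "\<dots> \<le> f p" by (rule p(2)[OF x0c])
    finally have fp: "ereal (c0 - u x0) \<le> f p" .
    then obtain c where c: "v p = ereal c" using fin[OF p(1)] by (cases "v p") (auto simp: f_def)
    have "\<epsilon> * \<rho> p \<le> \<epsilon> * M" using \<epsilon>(1) M(2)[OF p(1)] by simp
    then have "u p < c" using fp \<epsilon>(2) by (simp add: f_def c)
    then have "p \<notin> frontier G" using bdry c by (auto simp: u_def)
    then have pG: "p \<in> G" using p(1) G(1) by (simp add: frontier_def interior_open)
    have p\<Omega>: "\<Phi> p \<notin> CR" using p(1) G(3) \<Omega> by blast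
    obtain U \<phi> w where chart: "(U, \<phi>) \<in> charts_at A p" and w: "w \<noteq> 0"
        "chart_deriv U \<phi> \<Phi> p w \<in> vec.span {\<Phi> p, cnj_vec (\<Phi> p)}"
      using dir[OF p\<Omega>] by blast
    have U: "(U, \<phi>) \<in> A" "p \<in> U" using chart by (auto simp: charts_at_def)
    define x where "x \<zeta> = inv_into U \<phi> (\<phi> p + \<zeta> *s w)" for \<zeta>
    have xz: "x 0 = p" using chart_facts(6)[OF A U] by (simp add: x_def)
    obtain N g k where N: "open N" "0 \<in> N" "N \<subseteq> {\<zeta>. \<phi> p + \<zeta> *s w \<in> \<phi> ` U}"
        and g: "g holomorphic_on N" "g 0 = 0" and k: "0 < k"
        and \<rho>_ge: "\<And>\<zeta>. \<zeta> \<in> N \<Longrightarrow> \<rho> p + Re (g \<zeta>) + k * (cmod \<zeta>)\<^sup>2 \<le> \<rho> (x \<zeta>)"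
      using \<rho>(3)[rule_format, OF p(1) chart w(1)] xz unfolding strictly_subharmonic_at_0_def x_def by auto
    have Z0: "\<Phi> (x 0) = \<Phi> p" by (simp add: xz)
    have Zhol: "(\<lambda>\<zeta>. \<Phi> (x \<zeta>) $ i) holomorphic_on N" for i
      unfolding x_def by (rule holomorphic_on_subset[OF chart_line_holomorphic[OF hol U(1)] N(3)])
    have Zder: "((\<lambda>\<zeta>. \<Phi> (x \<zeta>)) has_derivative (\<lambda>\<zeta>. \<zeta> *s chart_deriv U \<phi> \<Phi> p w)) (at 0)"
      unfolding x_def by (rule chart_line_has_derivative[OF A hol U])
    \<comment> \<open>The perturbation gains \<open>\<epsilon> * k\<close> at second order. Half of
      it pays for the error of the tangent disc, the other half is the strict contact that gives the
      contradiction.\<close>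
    have "\<epsilon> * k / 2 > 0" using \<epsilon>(1) k by simp
    then obtain N' h where N': "open N'" "0 \<in> N'" "N' \<subseteq> N" and h: "h holomorphic_on N'" "h 0 = 0"
        and lie_le: "\<And>\<zeta>. \<zeta> \<in> N' \<Longrightarrow>
            ln (lie2 (\<Phi> (x \<zeta>))) \<le> ln (lie2 (\<Phi> p)) + Re (h \<zeta>) + \<epsilon> * k / 2 * (cmod \<zeta>)\<^sup>2"
      using ln_lie2_tangent_disc[OF card N(1,2) Zhol Zder] w(2) p\<Omega> unfolding Z0 by metis
    let ?V = "{\<zeta>. \<phi> p + \<zeta> *s w \<in> \<phi> ` (U \<inter> G)}"
    define N'' where "N'' = N' \<inter> ?V"
    have "subharmonic_on ?V (\<lambda>\<zeta>. (v \<circ> inv_into U \<phi>) (\<phi> p + \<zeta> *s w))"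
      using psh U(1) unfolding plurisubharmonic_def psh_on_def by blast
    then have "subharmonic_on ?V (\<lambda>\<zeta>. v (x \<zeta>))" by (simp add: x_def)
    then show False
    proof (rule subharmonic_no_strict_contact[where c = c and N = N'' and g = "\<lambda>\<zeta>. h \<zeta> - of_real \<epsilon> * g \<zeta>"
          and k = "\<epsilon> * k / 2"])
      show "v (x 0) = ereal c" by (simp add: xz c)
      show "open N''" unfolding N''_def
        by (intro open_Int N'(1) open_complex_line open_chart_image[OF A U(1) G(1)])
      show "0 \<in> N''" using N'(2) U(2) pG by (auto simp: N''_def)
      show "N'' \<subseteq> ?V" by (simp add: N''_def)
      show "(\<lambda>\<zeta>. h \<zeta> - of_real \<epsilon> * g \<zeta>) holomorphic_on N''"
        using N'(3) by (intro holomorphic_intros holomorphic_on_subset[OF h(1)] holomorphic_on_subset[OF g(1)])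
          (auto simp: N''_def)
      show "h 0 - of_real \<epsilon> * g 0 = 0" using h(2) g(2) by simp
      show "\<epsilon> * k / 2 > 0" by fact
      fix \<zeta> assume "\<zeta> \<in> N''"
      then have \<zeta>: "\<zeta> \<in> N'" "\<zeta> \<in> N" "\<phi> p + \<zeta> *s w \<in> \<phi> ` (U \<inter> G)"
        using N'(3) by (auto simp: N''_def)
      then have "x \<zeta> \<in> G" using chart_facts(6)[OF A U(1)] by (auto simp: x_def)
      then have xG: "x \<zeta> \<in> closure G" using closure_subset by blast
      \<comment> \<open>On \<open>closure G\<close> the cut-off is inactive, so the estimate for
        \<open>ln (lie2 (\<Phi> y))\<close> applies to \<open>u\<close> itself.\<close>
      have u_ln: "u y = ln (lie2 (\<Phi> y))" if "y \<in> closure G" for y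
        using G(3) that by (auto simp: u_def lie_potential_def \<Omega>)
      have u_le: "u (x \<zeta>) \<le> u p + Re (h \<zeta>) + \<epsilon> * k / 2 * (cmod \<zeta>)\<^sup>2"
        using lie_le[OF \<zeta>(1)] u_ln[OF xG] u_ln[OF p(1)] by simp
      have "\<epsilon> * (\<rho> p + Re (g \<zeta>) + k * (cmod \<zeta>)\<^sup>2) \<le> \<epsilon> * \<rho> (x \<zeta>)"
        using \<rho>_ge[OF \<zeta>(2)] \<epsilon>(1) by (intro mult_left_mono) auto
      then have \<rho>_ge': "\<epsilon> * \<rho> p + \<epsilon> * Re (g \<zeta>) + \<epsilon> * k * (cmod \<zeta>)\<^sup>2 \<le> \<epsilon> * \<rho> (x \<zeta>)"
        by (simp add: algebra_simps)
      have "v (x \<zeta>) + ereal (\<epsilon> * \<rho> (x \<zeta>) - u (x \<zeta>)) \<le> ereal (c + (\<epsilon> * \<rho> p - u p))"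
        using p(2)[OF xG] by (simp add: f_def c)
      then have "v (x \<zeta>) \<le> ereal (c + (\<epsilon> * \<rho> p - u p) - (\<epsilon> * \<rho> (x \<zeta>) - u (x \<zeta>)))"
        by (cases "v (x \<zeta>)") auto
      also have "\<dots> \<le> ereal (c + Re (h \<zeta> - of_real \<epsilon> * g \<zeta>) - \<epsilon> * k / 2 * (cmod \<zeta>)\<^sup>2)"
        using u_le \<rho>_ge' by simp
      finally show "v (x \<zeta>) \<le> ereal (c + Re (h \<zeta> - of_real \<epsilon> * g \<zeta>) - \<epsilon> * k / 2 * (cmod \<zeta>)\<^sup>2)" .
    qed
  qed
qed

section \<open>Parabolicity and the two criteria\<close>

lemma S_star_parabolic_of_tangent_direction:
  fixes A :: "('a::{t2_space,second_countable_topology}, 'n::finite) chart set"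
    and \<Phi> :: "'a \<Rightarrow> complex^'m::finite"
  assumes stein: "stein_manifold A" and hol: "holomorphic_map A \<Phi>" and card: "CARD('m) \<ge> 2"
    and proper: "proper_map euclidean euclidean \<Phi>" and CR: "compact (\<Phi> -` CR)"
    and dir: "\<And>x. \<Phi> x \<notin> CR \<Longrightarrow> \<exists>U \<phi> w. (U, \<phi>) \<in> charts_at A x \<and> w \<noteq> 0 \<and>
        chart_deriv U \<phi> \<Phi> x w \<in> vec.span {\<Phi> x, cnj_vec (\<Phi> x)}"
  shows "S_star_parabolic A"
proof -
  have A: "complex_atlas A" using stein by (simp add: stein_manifold_def)
  have cont: "continuous_on UNIV \<Phi>" by (rule holomorphic_map_continuous[OF A hol])
  have sub: "compact {x. lie2 (\<Phi> x) \<le> R}" for R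
  proof -
    have "compactin euclidean {x \<in> topspace euclidean. \<Phi> x \<in> cball 0 (sqrt R)}"
      by (rule compactin_proper_map_preimage[OF proper]) simp
    then have "compact {x. \<Phi> x \<in> cball 0 (sqrt R)}" by simp
    moreover have "closed {x. lie2 (\<Phi> x) \<le> R}"
      by (intro closed_Collect_le continuous_intros cont)
    moreover have "{x. lie2 (\<Phi> x) \<le> R} \<subseteq> {x. \<Phi> x \<in> cball 0 (sqrt R)}"
      using norm2_le_lie2 by (auto intro!: real_le_rsqrt intro: order_trans)
    ultimately show ?thesis by (metis closed_Int_compact inf.absorb1)
  qed
  \<comment> \<open>Outside \<open>K\<close> the point is off \<open>CR\<close> and above the
    cut-off level, the two conditions that the maximality argument asks for.\<close>
  define K where "K = \<Phi> -` CR \<union> {x. lie2 (\<Phi> x) \<le> 1}"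
  have K: "compact K" unfolding K_def by (intro compact_Un CR sub)
  have "- K = {x. \<Phi> x \<notin> CR \<and> 1 < lie2 (\<Phi> x)}" by (auto simp: K_def)
  then have "maximal_psh A (- K) (\<lambda>x. ereal (lie_potential \<Phi> x))"
    by (rule maximal_lie_potential[OF stein hol card _ dir])
  moreover have "compact (closure {x. lie_potential \<Phi> x \<le> c})" for c
  proof -
    have "lie2 (\<Phi> x) \<le> exp c" if "lie_potential \<Phi> x \<le> c" for x
    proof -
      have "max 1 (lie2 (\<Phi> x)) = exp (lie_potential \<Phi> x)" by (simp add: lie_potential_def)
      also have "\<dots> \<le> exp c" using that by simp
      finally show ?thesis by simp
    qed
    then have "closure {x. lie_potential \<Phi> x \<le> c} \<subseteq> {x. lie2 (\<Phi> x) \<le> exp c}"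
      by (intro closure_minimal compact_imp_closed sub) auto
    then show ?thesis using sub by (metis closed_Int_compact closed_closure inf.absorb1)
  qed
  ultimately have "continuous_parabolic_potential A (lie_potential \<Phi>)"
    unfolding continuous_parabolic_potential_def
    using K continuous_on_lie_potential[OF cont] plurisubharmonic_lie_potential[OF A hol card] by blast
  then show ?thesis using stein by (auto simp: S_star_parabolic_def)
qed

text \<open>With the whole space as exceptional compact set, maximality concerns only the empty open
  set, and a constant is a potential.\<close>

lemma S_star_parabolic_compact:
  fixes A :: "('a::{t2_space,second_countable_topology}, 'n::finite) chart set"
  assumes stein: "stein_manifold A" and "compact (UNIV :: 'a set)"
  shows "S_star_parabolic A"
proof -
  have const: "psh_on D (\<lambda>x. ereal 0)" for D :: "(complex^'n) set"
    by (rule psh_onI) (auto intro!: exI[of _ "\<lambda>_. 1"])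
  have psh: "plurisubharmonic A \<Omega> (\<lambda>x. ereal 0)" for \<Omega>
    using const by (auto simp: plurisubharmonic_def o_def)
  have "maximal_psh A (- UNIV) (\<lambda>x. ereal 0)"
    using psh[of "{}"] closure_subset by (fastforce simp: maximal_psh_def)
  then have "continuous_parabolic_potential A (\<lambda>x. 0)"
    unfolding continuous_parabolic_potential_def using psh[of UNIV] assms(2)
    by (auto intro: compact_Int_closed[of UNIV, simplified])
  then show ?thesis using stein by (auto simp: S_star_parabolic_def)
qed

lemma CR_UNIV:
  assumes "CARD('m::finite) = 1"
  shows "(CR :: (complex^'m) set) = UNIV"
proof -
  obtain j :: 'm where j: "UNIV = {j}" using assms card_1_singletonE by blast
  have "z = (z $ j) *s (\<chi> i. complex_of_real ((1 :: real^'m) $ i))" for z :: "complex^'m"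
  proof -
    have "i = j" for i using j by blast
    then show ?thesis by (simp add: vec_eq_iff) metis
  qed
  then show ?thesis unfolding CR_def by blast
qed

text \<open>If the conjugate of z were c z, then |c| = 1 and the forms \<open>l\<close> and
  \<open>cnj_vec l\<close> of an adapted frame would have equal moduli at z, which is impossible off
  \<open>CR\<close>.\<close>

lemma independent_cnj_vec:
  fixes z :: "complex^'m::finite"
  assumes card: "CARD('m) \<ge> 2" and z: "z \<notin> CR"
  shows "vec.independent {z, cnj_vec z}" "z \<noteq> cnj_vec z"
proof -
  obtain l where l: "cmod (bil (cnj_vec l) z) < cmod (bil l z)"
    using exists_adapted_frame[OF card] z by metis
  have nz: "norm (cnj_vec z) = norm z" by (simp add: norm_vec_def cnj_vec_def)
  have z0: "z \<noteq> 0" using l by (auto simp: bil_def)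
  have ne: "cnj_vec z \<noteq> c *s z" for c
  proof
    assume c: "cnj_vec z = c *s z"
    then have "cmod c = 1" using nz z0 by (simp add: norm_vec_scale)
    moreover have "cnj (bil (cnj_vec l) z) = c * bil l z"
      by (simp add: cnj_bil c bil_simps)
    ultimately have "cmod (bil (cnj_vec l) z) = cmod (bil l z)"
      by (metis complex_mod_cnj mult_1 norm_mult)
    then show False using l by simp
  qed
  from ne[of 1] show "z \<noteq> cnj_vec z" by auto
  have "vec.span {z} = range (\<lambda>c. c *s z)" by (rule vec.span_singleton)
  then have "cnj_vec z \<notin> vec.span {z}" using ne by auto
  then have "vec.independent (insert (cnj_vec z) {z})"
    using z0 by (intro vec.independent_insertI) (auto simp: vec.independent_empty)
  then show "vec.independent {z, cnj_vec z}" by (simp add: insert_commute)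
qed

text \<open>A kernel vector of \<open>D\<close> is mapped to 0, which lies in the plane. For
  injective \<open>D\<close> the image of dimension n and the plane of dimension 2 must meet
  nontrivially in dimension n + 1.\<close>

lemma tangent_direction_codim_1:
  fixes D :: "complex^'n::finite \<Rightarrow> complex^'m::finite"
  assumes lin: "Vector_Spaces.linear (*s) (*s) D" and dim: "CARD('m) = CARD('n) + 1" and z: "z \<notin> CR"
  shows "\<exists>w. w \<noteq> 0 \<and> D w \<in> vec.span {z, cnj_vec z}"
proof (cases "inj D")
  case False
  then obtain x y where xy: "D x = D y" "x \<noteq> y" by (auto simp: inj_def)
  have "D x = D (x - y) + D y"
    using lin unfolding Vector_Spaces.linear_iff by (metis diff_add_cancel)
  then have "D (x - y) = 0" using xy by simp
  then show ?thesis using xy(2) vec.span_zero by (intro exI[of _ "x - y"]) auto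
next
  case True
  have card: "CARD('m) \<ge> 2" using dim zero_less_card_finite[where 'a='n] by simp
  let ?P = "vec.span {z, cnj_vec z}"
  have "vec.subspace (range D)" using lin vec.linear_subspace_image vec.subspace_UNIV by blast
  then have "vec.dim {x + y |x y. x \<in> range D \<and> y \<in> ?P} + vec.dim (range D \<inter> ?P)
      = vec.dim (range D) + vec.dim ?P"
    by (intro vec.dim_sums_Int vec.subspace_span)
  moreover have "vec.dim (range D) = CARD('n)"
    using vec.dim_image_eq[OF lin, of UNIV] True by (simp add: card_cart_basis)
  moreover have "vec.dim ?P = 2"
    using vec.dim_span_eq_card_independent[OF independent_cnj_vec(1)[OF card z]]
      independent_cnj_vec(2)[OF card z] by simp
  moreover have "vec.dim {x + y |x y. x \<in> range D \<and> y \<in> ?P} \<le> CARD('m)"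
    by (rule dim_subset_UNIV_cart_gen)
  ultimately have "vec.dim (range D \<inter> ?P) \<noteq> 0" using dim by linarith
  then have "\<not> range D \<inter> ?P \<subseteq> {0}" by (metis vec.dim_eq_0)
  then obtain w where w: "D w \<in> ?P" "D w \<noteq> 0" by blast
  have "D 0 = 0" using lin by (simp add: vec.linear_0)
  then show ?thesis using w by (intro exI[of _ w]) auto
qed

theorem corollary1p2:
  fixes A :: "('a::{t2_space,second_countable_topology}, 'n::finite) chart set"
  assumes "stein_manifold A"
  shows
    "(CARD('m::finite) = CARD('n) + 1 \<longrightarrow>
      (\<exists>\<Phi> :: 'a \<Rightarrow> complex^'m.
         holomorphic_map A \<Phi> \<and> proper_map euclidean euclidean \<Phi> \<and> compact (\<Phi> -` CR)) \<longrightarrow>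
      S_star_parabolic A)
     \<and>
     (CARD('N::finite) \<ge> CARD('n) \<longrightarrow>
      (\<exists>\<Phi> :: 'a \<Rightarrow> complex^'N.
         holomorphic_map A \<Phi> \<and> proper_map euclidean euclidean \<Phi> \<and> compact (\<Phi> -` CR) \<and>
         (\<forall>z. \<exists>w\<in>tangent_space A z. w \<noteq> (\<lambda>_. 0) \<and>
            differential A \<Phi> z w \<in> vec.span {\<Phi> z, cnj_vec (\<Phi> z)})) \<longrightarrow>
      S_star_parabolic A)"
proof (intro conjI impI; elim exE conjE)
  have A: "complex_atlas A" using assms by (simp add: stein_manifold_def)
  {
    fix \<Phi> :: "'a \<Rightarrow> complex^'m"
    assume dim: "CARD('m) = CARD('n) + 1" and \<Phi>: "holomorphic_map A \<Phi>"
      "proper_map euclidean euclidean \<Phi>" "compact (\<Phi> -` CR)"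
    have card: "CARD('m) \<ge> 2" using dim zero_less_card_finite[where 'a='n] by simp
    show "S_star_parabolic A"
    proof (rule S_star_parabolic_of_tangent_direction[OF assms \<Phi>(1) card \<Phi>(2,3)])
      fix x assume x: "\<Phi> x \<notin> CR"
      obtain U \<phi> where c: "(U, \<phi>) \<in> charts_at A x" using atlas_cover[OF A] by blast
      then have U: "(U, \<phi>) \<in> A" "x \<in> U" by (auto simp: charts_at_def)
      have "Vector_Spaces.linear (*s) (*s) (chart_deriv U \<phi> \<Phi> x)"
        unfolding chart_deriv_def
        by (rule holomorphic_vec_onD(2)[OF holomorphic_map_in_chart[OF \<Phi>(1) U(1)]]) (use U(2) in simp)
      from tangent_direction_codim_1[OF this dim x] c
      show "\<exists>U \<phi> w. (U, \<phi>) \<in> charts_at A x \<and> w \<noteq> 0 \<and>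
        chart_deriv U \<phi> \<Phi> x w \<in> vec.span {\<Phi> x, cnj_vec (\<Phi> x)}" by blast
    qed
  next
    fix \<Phi> :: "'a \<Rightarrow> complex^'N"
    assume \<Phi>: "holomorphic_map A \<Phi>" "proper_map euclidean euclidean \<Phi>" "compact (\<Phi> -` CR)"
      and tan: "\<forall>z. \<exists>w\<in>tangent_space A z. w \<noteq> (\<lambda>_. 0) \<and>
            differential A \<Phi> z w \<in> vec.span {\<Phi> z, cnj_vec (\<Phi> z)}"
    show "S_star_parabolic A"
    proof (cases "CARD('N) = 1")
      case True
      then show ?thesis using S_star_parabolic_compact[OF assms] \<Phi>(3) by (simp add: CR_UNIV)
    next
      case False
      then have card: "CARD('N) \<ge> 2" using zero_less_card_finite[where 'a='N] by linarith
      show ?thesis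
      proof (rule S_star_parabolic_of_tangent_direction[OF assms \<Phi>(1) card \<Phi>(2,3)])
        fix x
        obtain w where w: "w \<in> tangent_space A x" "w \<noteq> (\<lambda>_. 0)"
            "differential A \<Phi> x w \<in> vec.span {\<Phi> x, cnj_vec (\<Phi> x)}"
          using tan by blast
        obtain U \<phi> where c: "(U, \<phi>) \<in> charts_at A x"
            "differential A \<Phi> x w = chart_deriv U \<phi> \<Phi> x (w (U, \<phi>))"
          using differential_in_chart[OF A] by metis
        then show "\<exists>U \<phi> w. (U, \<phi>) \<in> charts_at A x \<and> w \<noteq> 0 \<and>
            chart_deriv U \<phi> \<Phi> x w \<in> vec.span {\<Phi> x, cnj_vec (\<Phi> x)}"
          using tangent_vector_nonzero[OF A w(1,2) c(1)] w(3) by metis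
      qed
    qed
  }
qed

end
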